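(* Let $\mathbb{K}$ be a field of characteristic different from $2$, let $G=\mathbb{Z}_2^3$, let $D=\mathbb{K}[\mathsf{S}^7]\rtimes\mathbb{K}G$, let $r\in G$, and put $$p_0=\tfrac12(1_D+T_1^r),\qquad p_1=\tfrac12(1_D-T_1^r).$$ Then $$J_r=p_0\otimes 1_D+p_1\otimes T_1^r\in D\otimes D$$ is a twist for $D$ such that $J_r^{-1}=J_r$.
   Context: Work in the category of vector spaces over $\mathbb{K}$; a linear map $\mathbb{K}\to D\otimes D$ is identified with an element of $D\otimes D$. Let $\{\sigma_u\mid u\in G\}$ be the standard basis of the group algebra $\mathbb{K}G$. For $a,b\in G$ let $F(a,b)=(-1)^{\gamma(a,b)}$ with $\gamma(a,b)=\sum_{1\le i\le j\le 3}a_ib_j+a_1a_2b_3+a_1b_2a_3+b_1a_2a_3$, and for $c,u\in G$ let $\chi(c,u)=(-1)^{u\cdot c}$, where $u\cdot c$ is the $\mathbb{Z}_2$-scalar product. $\mathbb{K}[\mathsf{S}^7]$ is the commutative algebra generated by $f_a$, $a\in G$, with the relation $\sum_{a\in G}f_a^2=1$. It carries algebra morphisms $\varepsilon(f_c)=\delta_{c,0}$ (counit) and $\delta(f_c)=\sum_{a+b=c}F(a,b)\,f_a\otimes f_b$ (coproduct), and $G$ acts on it by algebra automorphisms via $\sigma_u\cdot f_c=\chi(c,u)f_c$. $D=\mathbb{K}[\mathsf{S}^7]\rtimes\mathbb{K}G$ is the vector space $\mathbb{K}[\mathsf{S}^7]\otimes\mathbb{K}G$ with product $(f\otimes\sigma_u)\bullet(g\otimes\sigma_v)=f(\sigma_u\cdot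 g)\otimes\sigma_{u+v}$, unit $1_D=1\otimes\sigma_0$, and the algebra morphisms $\varepsilon_D$, $\delta_D$ obtained from the tensor product of the counital comagma structures of $\mathbb{K}[\mathsf{S}^7]$ and $\mathbb{K}G$ (with $\sigma_u$ group-like). Writing $T_1^u=1\otimes\sigma_u$ and $T_c^u=f_c\otimes\sigma_u$, one has $\varepsilon_D(T_1^u)=1$, $\varepsilon_D(T_c^u)=\delta_{0,c}$, $\delta_D(T_1^u)=T_1^u\otimes T_1^u$, $\delta_D(T_c^u)=\sum_{a+b=c}F(a,b)\,T_a^u\otimes T_b^u$, and $T_1^u\bullet T_1^v=T_1^{u+v}$. $D$ is a Hopf coquasigroup; in particular it is an associative unital algebra with a counital, not necessarily coassociative, coproduct, and $\varepsilon_D,\delta_D$ are algebra morphisms. A twist for $D$ is an invertible element $J$ of the algebra $D\otimes D$ (with inverse denoted $J^{-1}$) satisfying, in the algebra $D\otimes D\otimes D$, $$(\delta_D\otimes\mathrm{id}_D)(J)\,(J\otimes 1_D)=(\mathrm{id}_D\otimes\delta_D)(J)\,(1_D\otimes J).$$ *)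

theory Defs
  imports "HOL-Analysis.Analysis" "HOL-Library.Z2" "HOL-Library.Poly_Mapping"
begin

section \<open>The group and the cochain\<close>

instance bit :: finite
proof
  have "(UNIV :: bit set) = {0, 1}"
    by (auto intro: bit.exhaust)
  then show "finite (UNIV :: bit set)"
    by (metis finite.emptyI finite_insert)
qed

type_synonym Z23 = "bit ^ 3"

definition minus_one_pow :: "bit \<Rightarrow> 'a::ring_1" where
  "minus_one_pow b = (if b = 0 then 1 else - 1)"

text \<open>The sum over indices \<open>i \<le> j\<close> is written out, since 3 = 0 in the index type and its order
  is therefore not the intended one.\<close>

definition cochain_exponent :: "Z23 \<Rightarrow> Z23 \<Rightarrow> bit" where
  "cochain_exponent a b =
     a$1 * b$1 + a$1 * b$2 + a$1 * b$3 + a$2 * b$2 + a$2 * b$3 + a$3 * b$3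
     + a$1 * a$2 * b$3 + a$1 * b$2 * a$3 + b$1 * a$2 * a$3"

definition cochain :: "Z23 \<Rightarrow> Z23 \<Rightarrow> 'a::ring_1" where
  "cochain a b = minus_one_pow (cochain_exponent a b)"

definition character :: "Z23 \<Rightarrow> Z23 \<Rightarrow> 'a::ring_1" where
  "character c u = minus_one_pow (\<Sum>i\<in>UNIV. u$i * c$i)"

lemma minus_one_pow_simps [simp]:
  "minus_one_pow 0 = 1" "minus_one_pow 1 = - 1"
  by (simp_all add: minus_one_pow_def)

lemma minus_one_pow_add: "minus_one_pow (a + b) = (minus_one_pow a * minus_one_pow b :: 'a::ring_1)"
  by (cases a; cases b) (simp_all add: minus_one_pow_def)

lemma minus_one_pow_square [simp]: "(minus_one_pow a)\<^sup>2 = (1 :: 'a::ring_1)"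
  by (cases a) simp_all

lemma character_square [simp]: "(character c u)\<^sup>2 = (1 :: 'a::ring_1)"
  by (simp add: character_def)

lemma character_0 [simp]: "character c 0 = (1 :: 'a::ring_1)"
  by (simp add: character_def)

lemma character_add: "character c (u + v) = (character c u * character c v :: 'a::ring_1)"
  by (simp only: character_def vector_add_component sum.distrib distrib_right minus_one_pow_add)

lemma Z23_add_self [simp]: "(a :: Z23) + a = 0"
  by (simp add: vec_eq_iff)

lemma Z23_uminus [simp]: "- (a :: Z23) = a"
  by (metis Z23_add_self add.inverse_unique)

lemma Z23_minus [simp]: "(a :: Z23) - b = a + b"
  by (metis Z23_uminus diff_conv_add_uminus)

lemma Z23_add_eq_0: "(a :: Z23) + b = 0 \<Longrightarrow> a = b"
  by (metis Z23_uminus add.inverse_unique)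

lemma Z23_add_cancel [simp]: "(a :: Z23) + (a + b) = b"
  by (simp flip: add.assoc)

section \<open>Evaluation of multivariate polynomials\<close>

text \<open>Polynomials over 'k in commuting variables indexed by 'x are the elements of
  \<^typ>\<open>('x \<Rightarrow>\<^sub>0 nat) \<Rightarrow>\<^sub>0 'k\<close>.\<close>

definition var :: "'x \<Rightarrow> ('x \<Rightarrow>\<^sub>0 nat) \<Rightarrow>\<^sub>0 'k::comm_ring_1" where
  "var a = Poly_Mapping.single (Poly_Mapping.single a 1) 1"

definition peval :: "('k \<Rightarrow> 'b) \<Rightarrow> ('x \<Rightarrow> 'b) \<Rightarrow> (('x::finite \<Rightarrow>\<^sub>0 nat) \<Rightarrow>\<^sub>0 'k::comm_ring_1) \<Rightarrow> 'b::comm_ring_1"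
  where "peval h g p =
    (\<Sum>m\<in>Poly_Mapping.keys p. h (Poly_Mapping.lookup p m) * (\<Prod>a\<in>UNIV. g a ^ Poly_Mapping.lookup m a))"

locale ring_morphism =
  fixes h :: "'a::ring_1 \<Rightarrow> 'b::ring_1"
  assumes h_add: "h (x + y) = h x + h y"
    and h_mult: "h (x * y) = h x * h y"
    and h_one: "h 1 = 1"
begin

lemma h_zero [simp]: "h 0 = 0"
  using h_add[of 0 0] by simp

lemma h_uminus: "h (- x) = - h x"
  using h_add[of x "- x"] by (simp add: eq_neg_iff_add_eq_0 add.commute)

lemma h_diff: "h (x - y) = h x - h y"
  using h_add[of x "- y"] by (simp add: h_uminus)

lemma h_sum: "h (sum f A) = (\<Sum>a\<in>A. h (f a))"
  by (induction A rule: infinite_finite_induct) (simp_all add: h_add)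

lemma h_power: "h (x ^ n) = h x ^ n"
  by (induction n) (simp_all add: h_one h_mult)

end

lemma poly_mapping_sum_single:
  "p = (\<Sum>m\<in>Poly_Mapping.keys p. Poly_Mapping.single m (Poly_Mapping.lookup p m))"
  by (rule poly_mapping_eqI)
    (auto simp: lookup_sum lookup_single when_def in_keys_iff)

lemma peval_single:
  assumes "ring_morphism h"
  shows "peval h g (Poly_Mapping.single m c) = h c * (\<Prod>a\<in>UNIV. g a ^ Poly_Mapping.lookup m a)"
  using ring_morphism.h_zero[OF assms] by (cases "c = 0") (simp_all add: peval_def)

lemma peval_add:
  assumes "ring_morphism h"
  shows "peval h g (p + q) = peval h g p + peval h g q"
  unfolding peval_def
  by (rule setsum_keys_plus_distrib)
    (simp_all add: ring_morphism.h_zero[OF assms] ring_morphism.h_add[OF assms] distrib_right)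

lemma peval_sum:
  assumes "ring_morphism h"
  shows "peval h g (sum f A) = (\<Sum>a\<in>A. peval h g (f a))"
proof (induction A rule: infinite_finite_induct)
qed (simp_all add: peval_add[OF assms], simp_all add: peval_def)

lemma peval_mult:
  assumes h: "ring_morphism h"
  shows "peval h g (p * q) = peval h g p * peval h g q"
proof -
  let ?s = "\<lambda>p m. Poly_Mapping.single m (Poly_Mapping.lookup p m)"
  have s: "peval h g (Poly_Mapping.single m c * Poly_Mapping.single n d) =
    peval h g (Poly_Mapping.single m c) * peval h g (Poly_Mapping.single n d)" for m n c d
    by (simp add: mult_single peval_single[OF h] ring_morphism.h_mult[OF h] lookup_add
        power_add prod.distrib)
  have "peval h g (p * q) =
    peval h g ((\<Sum>m\<in>Poly_Mapping.keys p. ?s p m) * (\<Sum>m\<in>Poly_Mapping.keys q. ?s q m))"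
    by (simp flip: poly_mapping_sum_single)
  also have "\<dots> = (\<Sum>m\<in>Poly_Mapping.keys p. peval h g (?s p m)) *
      (\<Sum>m\<in>Poly_Mapping.keys q. peval h g (?s q m))"
    by (simp add: sum_product peval_sum[OF h] s)
  also have "\<dots> = peval h g p * peval h g q"
    by (simp flip: peval_sum[OF h] poly_mapping_sum_single)
  finally show ?thesis .
qed

lemma ring_morphism_peval:
  assumes h: "ring_morphism h"
  shows "ring_morphism (peval h g)"
proof
  show "peval h g 1 = 1"
    using peval_single[OF h, of g 0 1] by (simp add: ring_morphism.h_one[OF h])
qed (simp_all add: peval_add[OF h] peval_mult[OF h])

lemma peval_var:
  assumes h: "ring_morphism h"
  shows "peval h g (var a) = g a"
proof -
  have "(\<Prod>b\<in>UNIV. g b ^ Poly_Mapping.lookup (Poly_Mapping.single a 1) b) =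
      (\<Prod>b\<in>UNIV. if b = a then g b else 1)"
    by (rule prod.cong) (auto simp: lookup_single when_def)
  then show ?thesis
    by (simp add: var_def peval_single[OF h] ring_morphism.h_one[OF h])
qed

lemma ring_morphism_id: "ring_morphism (\<lambda>x. x)"
  by unfold_locales simp_all

lemma ring_morphism_single_0:
  "ring_morphism (Poly_Mapping.single 0 :: 'k::comm_ring_1 \<Rightarrow> ('m::comm_monoid_add \<Rightarrow>\<^sub>0 'k))"
  by unfold_locales (simp_all add: single_add mult_single)

section \<open>The coordinate algebra of the seven-sphere\<close>

definition sphere_poly :: "(Z23 \<Rightarrow>\<^sub>0 nat) \<Rightarrow>\<^sub>0 'k::comm_ring_1" where
  "sphere_poly = (\<Sum>a\<in>UNIV. (var a)\<^sup>2) - 1"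

text \<open>The coordinate algebra is the quotient of the polynomial ring by the principal ideal
  generated by \<open>sphere_poly\<close>.\<close>

definition sphere_rel :: "((Z23 \<Rightarrow>\<^sub>0 nat) \<Rightarrow>\<^sub>0 'k::comm_ring_1) \<Rightarrow> _ \<Rightarrow> bool" where
  "sphere_rel p q \<longleftrightarrow> sphere_poly dvd (p - q)"

lemma sphere_rel_eqI: "p = q \<Longrightarrow> sphere_rel p q"
  by (simp add: sphere_rel_def)

lemma sphere_rel_respects:
  assumes h: "ring_morphism h" and g: "(\<Sum>a\<in>UNIV. (g a)\<^sup>2) = (1 :: 'b::comm_ring_1)"
    and r: "sphere_rel p q"
  shows "peval h g p = peval h g q"
proof -
  interpret e: ring_morphism "peval h g"
    by (rule ring_morphism_peval[OF h])
  have "peval h g sphere_poly = 0"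
    by (simp add: sphere_poly_def e.h_diff e.h_sum e.h_power e.h_one peval_var[OF h] g)
  moreover obtain k where "p - q = sphere_poly * k"
    using r by (auto simp: sphere_rel_def)
  then have "peval h g p - peval h g q = peval h g sphere_poly * peval h g k"
    by (simp only: e.h_mult flip: e.h_diff)
  ultimately show ?thesis
    by simp
qed

lemma sum_delta_square: "(\<Sum>a\<in>UNIV. (if a = (0::Z23) then 1 else 0)\<^sup>2) = (1 :: 'k::comm_ring_1)"
proof -
  have "(\<Sum>a\<in>UNIV. (if a = (0::Z23) then 1 else 0)\<^sup>2) = (\<Sum>a\<in>UNIV. if a = (0::Z23) then 1 else (0::'k))"
    by (rule sum.cong) auto
  then show ?thesis
    by simp
qed

lemma equivp_sphere_rel: "equivp (sphere_rel :: ((Z23 \<Rightarrow>\<^sub>0 nat) \<Rightarrow>\<^sub>0 'k::field) \<Rightarrow> _)"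
proof (rule equivpI)
  show "reflp (sphere_rel :: ((Z23 \<Rightarrow>\<^sub>0 nat) \<Rightarrow>\<^sub>0 'k) \<Rightarrow> _)"
    by (rule reflpI) (simp add: sphere_rel_def)
  show "symp (sphere_rel :: ((Z23 \<Rightarrow>\<^sub>0 nat) \<Rightarrow>\<^sub>0 'k) \<Rightarrow> _)"
  proof (rule sympI)
    fix p q :: "(Z23 \<Rightarrow>\<^sub>0 nat) \<Rightarrow>\<^sub>0 'k"
    assume "sphere_rel p q"
    then have "sphere_poly dvd - (p - q)"
      unfolding sphere_rel_def by (simp only: dvd_minus_iff)
    then show "sphere_rel q p"
      unfolding sphere_rel_def by (simp only: minus_diff_eq)
  qed
  show "transp (sphere_rel :: ((Z23 \<Rightarrow>\<^sub>0 nat) \<Rightarrow>\<^sub>0 'k) \<Rightarrow> _)"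
  proof (rule transpI)
    fix p q r :: "(Z23 \<Rightarrow>\<^sub>0 nat) \<Rightarrow>\<^sub>0 'k"
    assume "sphere_rel p q" "sphere_rel q r"
    then have "sphere_poly dvd (p - q) + (q - r)"
      unfolding sphere_rel_def by (rule dvd_add)
    then show "sphere_rel p r"
      unfolding sphere_rel_def by (simp only: diff_add_cancel add_diff_eq)
  qed
qed

quotient_type (overloaded) 'k sphere_alg = "(Z23 \<Rightarrow>\<^sub>0 nat) \<Rightarrow>\<^sub>0 'k::field" / sphere_rel
  by (rule equivp_sphere_rel)

lemma not_sphere_rel_0_1: "\<not> sphere_rel 0 (1 :: (Z23 \<Rightarrow>\<^sub>0 nat) \<Rightarrow>\<^sub>0 'k::field)"
proof
  let ?e = "peval (\<lambda>x::'k. x) (\<lambda>a::Z23. if a = 0 then 1 else 0)"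
  interpret e: ring_morphism ?e
    by (rule ring_morphism_peval[OF ring_morphism_id])
  assume "sphere_rel 0 (1 :: (Z23 \<Rightarrow>\<^sub>0 nat) \<Rightarrow>\<^sub>0 'k)"
  then have "?e 0 = ?e 1"
    by (rule sphere_rel_respects[OF ring_morphism_id sum_delta_square])
  then show False
    by (simp add: e.h_one)
qed

instantiation sphere_alg :: (field) comm_ring_1
begin

lift_definition zero_sphere_alg :: "'a sphere_alg" is 0 .
lift_definition one_sphere_alg :: "'a sphere_alg" is 1 .
lift_definition plus_sphere_alg :: "'a sphere_alg \<Rightarrow> 'a sphere_alg \<Rightarrow> 'a sphere_alg" is "(+)"
  unfolding sphere_rel_def by (simp add: add_diff_add dvd_add)
lift_definition uminus_sphere_alg :: "'a sphere_alg \<Rightarrow> 'a sphere_alg" is uminus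
  unfolding sphere_rel_def by (metis dvd_minus_iff minus_diff_minus)
lift_definition minus_sphere_alg :: "'a sphere_alg \<Rightarrow> 'a sphere_alg \<Rightarrow> 'a sphere_alg" is "(-)"
  unfolding sphere_rel_def
proof -
  fix p p' q q' :: "(Z23 \<Rightarrow>\<^sub>0 nat) \<Rightarrow>\<^sub>0 'a"
  assume "sphere_poly dvd (p - p')" "sphere_poly dvd (q - q')"
  then have "sphere_poly dvd (p - p') - (q - q')"
    by (rule dvd_diff)
  then show "sphere_poly dvd (p - q - (p' - q'))"
    by (simp add: algebra_simps)
qed
lift_definition times_sphere_alg :: "'a sphere_alg \<Rightarrow> 'a sphere_alg \<Rightarrow> 'a sphere_alg" is "(*)"
  unfolding sphere_rel_def
proof -
  fix p p' q q' :: "(Z23 \<Rightarrow>\<^sub>0 nat) \<Rightarrow>\<^sub>0 'a"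
  assume "sphere_poly dvd (p - p')" "sphere_poly dvd (q - q')"
  then have "sphere_poly dvd (p - p') * q + p' * (q - q')"
    by (simp add: dvd_add dvd_mult dvd_mult2)
  then show "sphere_poly dvd (p * q - p' * q')"
    by (simp add: algebra_simps)
qed

instance
proof
  fix a b c :: "'a sphere_alg"
  obtain p q r where [simp]: "a = abs_sphere_alg p" "b = abs_sphere_alg q" "c = abs_sphere_alg r"
    by (metis Quotient3_abs_rep[OF Quotient3_sphere_alg])
  show "a + b + c = a + (b + c)" "a + b = b + a" "0 + a = a" "- a + a = 0" "a - b = a + - b"
    "a * b * c = a * (b * c)" "a * b = b * a" "1 * a = a" "(a + b) * c = a * c + b * c"
    by (simp_all add: zero_sphere_alg_def one_sphere_alg_def plus_sphere_alg.abs_eq uminus_sphere_alg.abs_eq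
      minus_sphere_alg.abs_eq times_sphere_alg.abs_eq algebra_simps)
  show "(0 :: 'a sphere_alg) \<noteq> 1"
    by (simp add: zero_sphere_alg_def one_sphere_alg_def sphere_alg.abs_eq_iff not_sphere_rel_0_1)
qed

end

lift_definition sph_const :: "'k::field \<Rightarrow> 'k sphere_alg" is "Poly_Mapping.single 0" .

lift_definition f_gen :: "Z23 \<Rightarrow> 'k::field sphere_alg" is var .

definition sph_scale :: "'k::field \<Rightarrow> 'k sphere_alg \<Rightarrow> 'k sphere_alg" where
  "sph_scale c x = sph_const c * x"

lift_definition sph_act :: "Z23 \<Rightarrow> 'k::field sphere_alg \<Rightarrow> 'k sphere_alg"
  is "\<lambda>u. peval (Poly_Mapping.single 0) (\<lambda>c. character c u * var c)"
proof -
  fix u and p q :: "(Z23 \<Rightarrow>\<^sub>0 nat) \<Rightarrow>\<^sub>0 'k"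
  let ?e = "peval (Poly_Mapping.single 0) (\<lambda>c. character c u * var c) ::
    ((Z23 \<Rightarrow>\<^sub>0 nat) \<Rightarrow>\<^sub>0 'k) \<Rightarrow> _"
  note h = ring_morphism_single_0
  interpret e: ring_morphism ?e
    by (rule ring_morphism_peval[OF h])
  assume "sphere_rel p q"
  then obtain k where "p - q = sphere_poly * k"
    by (auto simp: sphere_rel_def)
  moreover have "?e sphere_poly = sphere_poly"
    by (simp add: sphere_poly_def e.h_diff e.h_sum e.h_power e.h_one peval_var[OF h]
        power_mult_distrib)
  ultimately have "?e p - ?e q = sphere_poly * ?e k"
    by (simp only: e.h_mult flip: e.h_diff)
  then show "sphere_rel (?e p) (?e q)"
    by (simp add: sphere_rel_def)
qed

lift_definition sph_counit :: "'k::field sphere_alg \<Rightarrow> 'k"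
  is "peval (\<lambda>x. x) (\<lambda>c. if c = 0 then 1 else 0)"
  by (rule sphere_rel_respects[OF ring_morphism_id sum_delta_square])

lemma sphere_relation: "(\<Sum>a\<in>UNIV. (f_gen a)\<^sup>2) = (1 :: 'k::field sphere_alg)"
proof -
  have sum: "(\<Sum>a\<in>A. abs_sphere_alg (f a)) = abs_sphere_alg (\<Sum>a\<in>A. f a)"
    for A and f :: "Z23 \<Rightarrow> (Z23 \<Rightarrow>\<^sub>0 nat) \<Rightarrow>\<^sub>0 'k"
    by (induction A rule: infinite_finite_induct)
      (simp_all add: plus_sphere_alg.abs_eq zero_sphere_alg.abs_eq)
  have "(\<Sum>a\<in>UNIV. (f_gen a)\<^sup>2) = abs_sphere_alg (\<Sum>a\<in>UNIV. (var a :: (Z23 \<Rightarrow>\<^sub>0 nat) \<Rightarrow>\<^sub>0 'k)\<^sup>2)"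
    by (simp add: f_gen.abs_eq power2_eq_square times_sphere_alg.abs_eq sum)
  also have "\<dots> = 1"
    by (simp add: one_sphere_alg.abs_eq sphere_alg.abs_eq_iff sphere_rel_def sphere_poly_def)
  finally show ?thesis .
qed

lemma ring_morphism_sph_const: "ring_morphism (sph_const :: 'k::field \<Rightarrow> _)"
  by unfold_locales
    (simp_all add: sph_const.abs_eq plus_sphere_alg.abs_eq times_sphere_alg.abs_eq one_sphere_alg.abs_eq
      single_add mult_single)

lemma ring_morphism_sph_act: "ring_morphism (sph_act u :: 'k::field sphere_alg \<Rightarrow> _)"
proof -
  interpret e: ring_morphism "peval (Poly_Mapping.single 0) (\<lambda>c. character c u * var c) ::
      ((Z23 \<Rightarrow>\<^sub>0 nat) \<Rightarrow>\<^sub>0 'k) \<Rightarrow> _"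
    by (rule ring_morphism_peval[OF ring_morphism_single_0])
  have "sph_act u (x + y) = sph_act u x + sph_act u y"
    "sph_act u (x * y) = sph_act u x * sph_act u y" for x y :: "'k sphere_alg"
  proof -
    obtain p q where "x = abs_sphere_alg p" "y = abs_sphere_alg q"
      by (metis Quotient3_abs_rep[OF Quotient3_sphere_alg])
    then show "sph_act u (x + y) = sph_act u x + sph_act u y"
      "sph_act u (x * y) = sph_act u x * sph_act u y"
      by (simp_all add: plus_sphere_alg.abs_eq times_sphere_alg.abs_eq sph_act.abs_eq e.h_add e.h_mult)
  qed
  moreover have "sph_act u (1 :: 'k sphere_alg) = 1"
    by (simp add: one_sphere_alg_def sph_act.abs_eq e.h_one)
  ultimately show ?thesis
    by (simp add: ring_morphism_def)
qed

lemma ring_morphism_sph_counit: "ring_morphism (sph_counit :: 'k::field sphere_alg \<Rightarrow> _)"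
proof -
  interpret e: ring_morphism "peval (\<lambda>x::'k. x) (\<lambda>c::Z23. if c = 0 then 1 else 0)"
    by (rule ring_morphism_peval[OF ring_morphism_id])
  show ?thesis
    by unfold_locales (transfer, simp only: e.h_add e.h_mult e.h_one; fail)+
qed

lemma sph_act_const [simp]: "sph_act u (sph_const c) = sph_const c"
  by transfer (simp add: peval_single[OF ring_morphism_single_0] sphere_rel_def)

lemma sph_counit_const [simp]: "sph_counit (sph_const c) = c"
  by transfer (simp add: peval_single[OF ring_morphism_id])

lemma sph_counit_gen: "sph_counit (f_gen c) = (if c = 0 then 1 else 0)"
  by transfer (simp add: peval_var[OF ring_morphism_id])

lemma sph_act_gen: "sph_act u (f_gen c) = character c u * f_gen c"
proof -
  have "abs_sphere_alg (character c u) = character c u"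
    unfolding character_def minus_one_pow_def
    by (simp add: one_sphere_alg_def uminus_sphere_alg.abs_eq)
  moreover have "sph_act u (f_gen c) = abs_sphere_alg (character c u * var c)"
    by (simp add: f_gen.abs_eq sph_act.abs_eq peval_var[OF ring_morphism_single_0])
  ultimately show ?thesis
    by (metis f_gen.abs_eq times_sphere_alg.abs_eq)
qed

lemma ring_morphism_h_peval:
  fixes g :: "'x::finite \<Rightarrow> 'b::comm_ring_1" and h :: "'b \<Rightarrow> 'c::comm_ring_1"
  assumes h: "ring_morphism h" and k: "ring_morphism k"
  shows "h (peval k g p) = peval (\<lambda>c. h (k c)) (\<lambda>a. h (g a)) p"
proof -
  interpret h: ring_morphism h by (rule h)
  have prod: "h (\<Prod>a\<in>A. f a) = (\<Prod>a\<in>A. h (f a))" for f :: "'x \<Rightarrow> _" and A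
    by (induction A rule: infinite_finite_induct) (simp_all add: h.h_one h.h_mult)
  show ?thesis
    by (simp add: peval_def h.h_sum h.h_mult h.h_power prod)
qed

lemma ring_morphism_abs_sphere: "ring_morphism (abs_sphere_alg :: _ \<Rightarrow> 'k::field sphere_alg)"
  by unfold_locales (simp_all add: plus_sphere_alg.abs_eq times_sphere_alg.abs_eq one_sphere_alg_def)

lemma abs_sphere_peval: "abs_sphere_alg p = peval sph_const f_gen (p :: _ \<Rightarrow>\<^sub>0 'k::field)"
proof -
  interpret e: ring_morphism "peval (Poly_Mapping.single 0) var ::
      ((Z23 \<Rightarrow>\<^sub>0 nat) \<Rightarrow>\<^sub>0 'k) \<Rightarrow> _"
    by (rule ring_morphism_peval[OF ring_morphism_single_0])
  have power: "(var a :: _ \<Rightarrow>\<^sub>0 'k) ^ n = Poly_Mapping.single (Poly_Mapping.single a n) 1" for a :: Z23 and n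
    by (induction n) (simp_all add: var_def mult_single flip: single_add)
  have prod: "(\<Prod>a\<in>A. Poly_Mapping.single (g a) (1::'k)) = Poly_Mapping.single (\<Sum>a\<in>A. g a) 1"
    for A and g :: "Z23 \<Rightarrow> Z23 \<Rightarrow>\<^sub>0 nat"
    by (induction A rule: infinite_finite_induct) (simp_all add: mult_single)
  have m: "(\<Sum>a\<in>UNIV. Poly_Mapping.single a (Poly_Mapping.lookup m a)) = m"
    for m :: "Z23 \<Rightarrow>\<^sub>0 nat"
    by (rule poly_mapping_eqI) (simp add: lookup_sum lookup_single when_def)
  have "peval (Poly_Mapping.single 0) var (Poly_Mapping.single m c) = Poly_Mapping.single m c"
    for m :: "Z23 \<Rightarrow>\<^sub>0 nat" and c :: 'k
    by (simp add: peval_single[OF ring_morphism_single_0] power prod m mult_single)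
  then have "peval (Poly_Mapping.single 0) var p = p"
    by (subst (1 2) poly_mapping_sum_single) (simp only: e.h_sum)
  then have "abs_sphere_alg p = abs_sphere_alg (peval (Poly_Mapping.single 0) var p)"
    by simp
  also have "\<dots> = peval sph_const f_gen p"
    by (simp add: ring_morphism_h_peval[OF ring_morphism_abs_sphere ring_morphism_single_0]
        flip: sph_const.abs_eq f_gen.abs_eq)
  finally show ?thesis .
qed

lemma sphere_morphism_eqI:
  assumes h: "ring_morphism h" "ring_morphism h'"
    and const: "\<And>c. h (sph_const c) = h' (sph_const c)"
    and gen: "\<And>a. h (f_gen a) = (h' (f_gen a) :: 'b::comm_ring_1)"
  shows "h x = h' (x :: 'k::field sphere_alg)"
proof -
  obtain p where x: "x = abs_sphere_alg p"
    by (metis Quotient3_abs_rep[OF Quotient3_sphere_alg])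
  show ?thesis
    unfolding x abs_sphere_peval
    by (simp add: ring_morphism_h_peval[OF _ ring_morphism_sph_const] h const gen)
qed

lemma sph_act_0 [simp]: "sph_act 0 x = (x :: 'k::field sphere_alg)"
  by (rule sphere_morphism_eqI[OF ring_morphism_sph_act ring_morphism_id])
    (simp_all add: sph_act_gen)

lemma sph_act_act: "sph_act u (sph_act v x) = sph_act (u + v) (x :: 'k::field sphere_alg)"
proof -
  interpret u: ring_morphism "sph_act u :: 'k sphere_alg \<Rightarrow> _" by (rule ring_morphism_sph_act)
  interpret v: ring_morphism "sph_act v :: 'k sphere_alg \<Rightarrow> _" by (rule ring_morphism_sph_act)
  have "ring_morphism (\<lambda>x. sph_act u (sph_act v x :: 'k sphere_alg))"
    by unfold_locales (simp_all add: u.h_add v.h_add u.h_mult v.h_mult u.h_one v.h_one)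
  moreover have "sph_act u (character c v :: 'k sphere_alg) = character c v" for c
    by (cases "(\<Sum>i\<in>UNIV. v$i * c$i) = 0")
      (simp_all only: character_def minus_one_pow_def simp_thms if_True if_False
        u.h_uminus u.h_one)
  then have "sph_act u (sph_act v (f_gen a)) = sph_act (u + v) (f_gen a :: 'k sphere_alg)" for a
    by (simp only: sph_act_gen u.h_mult character_add mult_ac)
  ultimately show ?thesis
    using sphere_morphism_eqI[OF _ ring_morphism_sph_act, of "\<lambda>x. sph_act u (sph_act v x)" "u + v" x]
    by (simp only: sph_act_const)
qed

section \<open>Tensor powers of an algebra\<close>

text \<open>Elements of a tensor power are finite formal sums, written as multisets, of pure tensors,
  modulo the congruence generated by additivity in each factor and by moving scalars between
  factors. The action s c x of a scalar c on the first factor then extends to the tensor power.\<close>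

inductive tensor2_rel ::
  "('k::field \<Rightarrow> 'v::ab_group_add \<Rightarrow> 'v) \<Rightarrow> ('v \<times> 'v) multiset \<Rightarrow> ('v \<times> 'v) multiset \<Rightarrow> bool"
  for s where
  tensor2_refl: "tensor2_rel s M M"
| tensor2_sym: "tensor2_rel s M N \<Longrightarrow> tensor2_rel s N M"
| tensor2_trans: "tensor2_rel s M N \<Longrightarrow> tensor2_rel s N P \<Longrightarrow> tensor2_rel s M P"
| tensor2_plus: "tensor2_rel s M N \<Longrightarrow> tensor2_rel s (M + P) (N + P)"
| tensor2_zero: "tensor2_rel s {#(0, y)#} {#}"
| tensor2_add1: "tensor2_rel s {#(x + x', y)#} {#(x, y), (x', y)#}"
| tensor2_add2: "tensor2_rel s {#(x, y + y')#} {#(x, y), (x, y')#}"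
| tensor2_scale12: "tensor2_rel s {#(s c x, y)#} {#(x, s c y)#}"

inductive tensor3_rel ::
  "('k::field \<Rightarrow> 'v::ab_group_add \<Rightarrow> 'v) \<Rightarrow> ('v \<times> 'v \<times> 'v) multiset \<Rightarrow> ('v \<times> 'v \<times> 'v) multiset \<Rightarrow> bool"
  for s where
  tensor3_refl: "tensor3_rel s M M"
| tensor3_sym: "tensor3_rel s M N \<Longrightarrow> tensor3_rel s N M"
| tensor3_trans: "tensor3_rel s M N \<Longrightarrow> tensor3_rel s N P \<Longrightarrow> tensor3_rel s M P"
| tensor3_plus: "tensor3_rel s M N \<Longrightarrow> tensor3_rel s (M + P) (N + P)"
| tensor3_zero: "tensor3_rel s {#(0, y, z)#} {#}"
| tensor3_add1: "tensor3_rel s {#(x + x', y, z)#} {#(x, y, z), (x', y, z)#}"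
| tensor3_add2: "tensor3_rel s {#(x, y + y', z)#} {#(x, y, z), (x, y', z)#}"
| tensor3_add3: "tensor3_rel s {#(x, y, z + z')#} {#(x, y, z), (x, y, z')#}"
| tensor3_scale12: "tensor3_rel s {#(s c x, y, z)#} {#(x, s c y, z)#}"
| tensor3_scale23: "tensor3_rel s {#(x, s c y, z)#} {#(x, y, s c z)#}"

lemma equivp_tensor2_rel: "equivp (tensor2_rel s)"
  by (intro equivpI reflpI sympI transpI)
    (rule tensor2_refl, erule tensor2_sym, erule (1) tensor2_trans)

lemma equivp_tensor3_rel: "equivp (tensor3_rel s)"
  by (intro equivpI reflpI sympI transpI)
    (rule tensor3_refl, erule tensor3_sym, erule (1) tensor3_trans)

locale congruence =
  fixes R :: "'m::comm_monoid_add \<Rightarrow> 'm \<Rightarrow> bool"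
  assumes R_equivp: "equivp R"
    and R_plus: "R M N \<Longrightarrow> R (M + P) (N + P)"
begin

lemma R_refl [simp]: "R M M"
  using R_equivp by (rule equivp_reflp)

lemma R_sym: "R M N \<Longrightarrow> R N M"
  using R_equivp by (rule equivp_symp)

lemma R_trans [trans]: "R M N \<Longrightarrow> R N P \<Longrightarrow> R M P"
  using R_equivp by (rule equivp_transp)

lemma R_add: "R M N \<Longrightarrow> R M' N' \<Longrightarrow> R (M + M') (N + N')"
  using R_trans[OF R_plus[of M N M'] R_plus[of M' N' N, unfolded add.commute[of _ N]]]
  by (simp add: add.commute)

lemma R_sum_mset: "(\<And>p. R (f p) (g p)) \<Longrightarrow> R (\<Sum>p\<in>#M. f p) (\<Sum>p\<in>#M. g p)"
  by (induction M) (simp_all add: R_add)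

lemma R_sum_mset_add:
  assumes "\<And>p. R (f p) (g p + h p)"
  shows "R (\<Sum>p\<in>#M. f p) ((\<Sum>p\<in>#M. g p) + (\<Sum>p\<in>#M. h p))"
  using R_sum_mset[of f "\<lambda>p. g p + h p" M, OF assms] by (simp add: sum_mset.distrib)

lemma R_sum_mset_zero: "(\<And>p. R (f p) 0) \<Longrightarrow> R (\<Sum>p\<in>#M. f p) 0"
  using R_sum_mset[of f "\<lambda>_. 0" M] by simp

lemma tensor2_lift:
  fixes s :: "'k::field \<Rightarrow> 'v::ab_group_add \<Rightarrow> 'v"
  assumes "tensor2_rel s M N"
    and "\<And>y. R (h (0, y)) 0"
    and "\<And>x x' y. R (h (x + x', y)) (h (x, y) + h (x', y))"
    and "\<And>x y y'. R (h (x, y + y')) (h (x, y) + h (x, y'))"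
    and "\<And>c x y. R (h (s c x, y)) (h (x, s c y))"
  shows "R (\<Sum>p\<in>#M. h p) (\<Sum>p\<in>#N. h p)"
  using assms(1)
proof (induction rule: tensor2_rel.induct)
  case (tensor2_sym M N)
  show ?case
    using tensor2_sym.IH by (rule R_sym)
next
  case (tensor2_trans M N P)
  show ?case
    using tensor2_trans.IH by (rule R_trans)
next
  case (tensor2_plus M N P)
  then show ?case
    by (simp add: R_plus)
next
  case (tensor2_add1 x x' y)
  then show ?case
    using assms(3)[of x x' y] by (simp add: add.commute)
next
  case (tensor2_add2 x y y')
  then show ?case
    using assms(4)[of x y y'] by (simp add: add.commute)
next
  case (tensor2_zero y)
  then show ?case
    using assms(2)[of y] by simp
next
  case tensor2_scale12
  show ?case
    by (simp add: assms(5))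
qed simp

lemma tensor3_lift:
  fixes s :: "'k::field \<Rightarrow> 'v::ab_group_add \<Rightarrow> 'v"
  assumes "tensor3_rel s M N"
    and "\<And>y z. R (h (0, y, z)) 0"
    and "\<And>x x' y z. R (h (x + x', y, z)) (h (x, y, z) + h (x', y, z))"
    and "\<And>x y y' z. R (h (x, y + y', z)) (h (x, y, z) + h (x, y', z))"
    and "\<And>x y z z'. R (h (x, y, z + z')) (h (x, y, z) + h (x, y, z'))"
    and "\<And>c x y z. R (h (s c x, y, z)) (h (x, s c y, z))"
    and "\<And>c x y z. R (h (x, s c y, z)) (h (x, y, s c z))"
  shows "R (\<Sum>p\<in>#M. h p) (\<Sum>p\<in>#N. h p)"
  using assms(1)
proof (induction rule: tensor3_rel.induct)
  case (tensor3_sym M N)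
  show ?case
    using tensor3_sym.IH by (rule R_sym)
next
  case (tensor3_trans M N P)
  show ?case
    using tensor3_trans.IH by (rule R_trans)
next
  case (tensor3_plus M N P)
  then show ?case
    by (simp add: R_plus)
next
  case (tensor3_add1 x x' y z)
  then show ?case
    using assms(3)[of x x' y z] by (simp add: add.commute)
next
  case (tensor3_add2 x y y' z)
  then show ?case
    using assms(4)[of x y y' z] by (simp add: add.commute)
next
  case (tensor3_add3 x y z z')
  then show ?case
    using assms(5)[of x y z z'] by (simp add: add.commute)
next
  case (tensor3_zero y z)
  then show ?case
    using assms(2)[of y z] by simp
next
  case tensor3_scale12
  show ?case
    by (simp add: assms(6))
next
  case tensor3_scale23
  show ?case
    by (simp add: assms(7))
qed simp

end

interpretation eq_congruence: congruence "(=) :: 'm::comm_monoid_add \<Rightarrow> _"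
  by unfold_locales (simp_all add: identity_equivp)

interpretation tensor2_congruence: congruence "tensor2_rel s"
  by unfold_locales (simp_all add: equivp_tensor2_rel tensor2_plus)

interpretation tensor3_congruence: congruence "tensor3_rel s"
  by unfold_locales (simp_all add: equivp_tensor3_rel tensor3_plus)

definition mult2 :: "('v::times \<times> 'v) multiset \<Rightarrow> ('v \<times> 'v) multiset \<Rightarrow> ('v \<times> 'v) multiset" where
  "mult2 M N = (\<Sum>(x, y)\<in>#M. \<Sum>(x', y')\<in>#N. {#(x * x', y * y')#})"

definition mult3 ::
  "('v::times \<times> 'v \<times> 'v) multiset \<Rightarrow> ('v \<times> 'v \<times> 'v) multiset \<Rightarrow> ('v \<times> 'v \<times> 'v) multiset" where
  "mult3 M N = (\<Sum>(x, y, z)\<in>#M. \<Sum>(x', y', z')\<in>#N. {#(x * x', y * y', z * z')#})"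

definition uminus2 :: "('v::uminus \<times> 'v) multiset \<Rightarrow> ('v \<times> 'v) multiset" where
  "uminus2 M = (\<Sum>(x, y)\<in>#M. {#(- x, y)#})"

definition uminus3 :: "('v::uminus \<times> 'v \<times> 'v) multiset \<Rightarrow> ('v \<times> 'v \<times> 'v) multiset" where
  "uminus3 M = (\<Sum>(x, y, z)\<in>#M. {#(- x, y, z)#})"

definition scale2 :: "('k \<Rightarrow> 'v \<Rightarrow> 'v) \<Rightarrow> 'k \<Rightarrow> ('v \<times> 'v) multiset \<Rightarrow> ('v \<times> 'v) multiset" where
  "scale2 s c M = (\<Sum>(x, y)\<in>#M. {#(s c x, y)#})"

lemma multiset_sum_induct [case_names empty single union]:
  assumes "P {#}" "\<And>p. P {#p#}" "\<And>M N. P M \<Longrightarrow> P N \<Longrightarrow> P (M + N)"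
  shows "P M"
proof (induction M)
  case (add p M)
  then show ?case
    using assms(3)[of "{#p#}" M] assms(2)[of p] by simp
qed (rule assms)

lemma mult2_simps [simp]:
  "mult2 {#} N = {#}" "mult2 M {#} = {#}"
  "mult2 (M + M') N = mult2 M N + mult2 M' N"
  "mult2 M (N + N') = mult2 M N + mult2 M N'"
  "mult2 {#(x, y)#} {#(x', y')#} = {#(x * x', y * y')#}"
  by (simp_all add: mult2_def case_prod_unfold sum_mset.distrib)

lemma mult3_simps [simp]:
  "mult3 {#} N = {#}" "mult3 M {#} = {#}"
  "mult3 (M + M') N = mult3 M N + mult3 M' N"
  "mult3 M (N + N') = mult3 M N + mult3 M N'"
  "mult3 {#(x, y, z)#} {#(x', y', z')#} = {#(x * x', y * y', z * z')#}"
  by (simp_all add: mult3_def case_prod_unfold sum_mset.distrib)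

lemma mult2_assoc:
  "mult2 (mult2 M N) P = mult2 M (mult2 N (P :: ('v::semigroup_mult \<times> 'v) multiset))"
proof (induction M rule: multiset_sum_induct)
  case (single p)
  show ?case
  proof (induction N rule: multiset_sum_induct)
    case (single q)
    show ?case
    proof (induction P rule: multiset_sum_induct)
      case (single r)
      show ?case
        by (cases p; cases q; cases r) (simp add: mult.assoc)
    qed simp_all
  qed simp_all
qed simp_all

lemma mult3_assoc:
  "mult3 (mult3 M N) P = mult3 M (mult3 N (P :: ('v::semigroup_mult \<times> 'v \<times> 'v) multiset))"
proof (induction M rule: multiset_sum_induct)
  case (single p)
  show ?case
  proof (induction N rule: multiset_sum_induct)
    case (single q)
    show ?case
    proof (induction P rule: multiset_sum_induct)
      case (single r)
      show ?case
        by (cases p; cases q; cases r) (simp add: mult.assoc)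
    qed simp_all
  qed simp_all
qed simp_all

lemma mult2_commute: "mult2 M N = mult2 N (M :: ('v::ab_semigroup_mult \<times> 'v) multiset)"
proof (induction M rule: multiset_sum_induct)
  case (single p)
  show ?case
  proof (induction N rule: multiset_sum_induct)
    case (single q)
    show ?case
      by (cases p; cases q) (simp add: mult.commute)
  qed simp_all
qed simp_all

lemma mult2_one: "mult2 {#(1, 1)#} M = M" "mult2 M {#(1, 1)#} = (M :: ('v::monoid_mult \<times> 'v) multiset)"
  by (induction M rule: multiset_sum_induct; force)+

lemma mult3_one:
  "mult3 {#(1, 1, 1)#} M = M" "mult3 M {#(1, 1, 1)#} = (M :: ('v::monoid_mult \<times> 'v \<times> 'v) multiset)"
  by (induction M rule: multiset_sum_induct; force)+

locale scaled_ring =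
  fixes s :: "'k::field \<Rightarrow> 'v::ring_1 \<Rightarrow> 'v"
  assumes s_add: "s c (x + y) = s c x + s c y"
    and s_mult_left: "s c x * y = s c (x * y)"
    and s_mult_right: "x * s c y = s c (x * y)"
    and s_s: "s c (s d x) = s (c * d) x"
begin

lemma s_zero [simp]: "s c 0 = 0"
  using s_add[of c 0 0] by simp

lemma s_uminus: "s c (- x) = - s c x"
  using s_add[of c x "- x"] by (simp add: eq_neg_iff_add_eq_0 add.commute)

lemma pair_add1: "tensor2_rel s {#(x + x', y)#} ({#(x, y)#} + {#(x', y)#})"
  using tensor2_add1[of s x x' y] by (simp add: add_mset_commute)

lemma pair_add2: "tensor2_rel s {#(x, y + y')#} ({#(x, y)#} + {#(x, y')#})"
  using tensor2_add2[of s x y y'] by (simp add: add_mset_commute)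

lemma pair_zero: "tensor2_rel s {#(0, y)#} 0"
  using tensor2_zero[of s y] by simp

lemma triple_add1: "tensor3_rel s {#(x + x', y, z)#} ({#(x, y, z)#} + {#(x', y, z)#})"
  using tensor3_add1[of s x x' y z] by (simp add: add_mset_commute)

lemma triple_add2: "tensor3_rel s {#(x, y + y', z)#} ({#(x, y, z)#} + {#(x, y', z)#})"
  using tensor3_add2[of s x y y' z] by (simp add: add_mset_commute)

lemma triple_add3: "tensor3_rel s {#(x, y, z + z')#} ({#(x, y, z)#} + {#(x, y, z')#})"
  using tensor3_add3[of s x y z z'] by (simp add: add_mset_commute)

lemma triple_zero: "tensor3_rel s {#(0, y, z)#} 0"
  using tensor3_zero[of s y z] by simp

lemma triple_zero2: "tensor3_rel s {#(x, 0, z)#} 0"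
proof -
  let ?a = "{#(x, 0, z)#}" and ?b = "{#(- x, 0, z)#}"
  have b: "tensor3_rel s (?a + ?b) 0"
    using tensor3_trans[OF tensor3_sym[OF triple_add1[of x "- x" 0 z]]] triple_zero[of 0 z] by simp
  have "tensor3_rel s 0 (?a + ?b)"
    by (rule tensor3_sym) (rule b)
  also have "tensor3_rel s (?a + ?b) (?a + ?a + ?b)"
    using triple_add2[of x 0 0 z] by (intro tensor3_plus) simp
  also have "tensor3_rel s (?a + ?a + ?b) (0 + ?a)"
    using tensor3_plus[OF b, of ?a] by (simp only: add_ac)
  finally show ?thesis
    by (simp only: add_0_left) (rule tensor3_sym)
qed

lemma mult2_left:
  assumes "tensor2_rel s M M'"
  shows "tensor2_rel s (mult2 M N) (mult2 M' N)"
  unfolding mult2_def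
proof (rule tensor2_congruence.tensor2_lift[OF assms], goal_cases)
  case 1 show ?case by (auto intro!: tensor2_congruence.R_sum_mset_zero pair_zero)
next
  case 2 show ?case
    by (unfold case_prod_conv, rule tensor2_congruence.R_sum_mset_add)
      (simp only: split_paired_all case_prod_conv distrib_right pair_add1)
next
  case 3 show ?case
    by (unfold case_prod_conv, rule tensor2_congruence.R_sum_mset_add)
      (simp only: split_paired_all case_prod_conv distrib_right pair_add2)
next
  case 4 show ?case
    by (unfold case_prod_conv, rule tensor2_congruence.R_sum_mset)
      (simp only: split_paired_all case_prod_conv s_mult_left tensor2_scale12)
qed

lemma mult2_right:
  assumes "tensor2_rel s N N'"
  shows "tensor2_rel s (mult2 M N) (mult2 M N')"
  unfolding mult2_def
proof (rule tensor2_congruence.R_sum_mset, clarify, goal_cases)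
  case (1 x y)
  show ?case
  proof (rule tensor2_congruence.tensor2_lift[OF assms], goal_cases)
    case 4 show ?case
      using tensor2_scale12 by (simp add: s_mult_right)
  qed (simp_all only: case_prod_conv distrib_left mult_zero_right pair_zero pair_add1 pair_add2)
qed

lemma mult2_cong:
  "tensor2_rel s M M' \<Longrightarrow> tensor2_rel s N N' \<Longrightarrow> tensor2_rel s (mult2 M N) (mult2 M' N')"
  using mult2_left mult2_right tensor2_trans by blast

lemma mult3_left:
  assumes "tensor3_rel s M M'"
  shows "tensor3_rel s (mult3 M N) (mult3 M' N)"
  unfolding mult3_def
proof (rule tensor3_congruence.tensor3_lift[OF assms], goal_cases)
  case 1 show ?case by (auto intro!: tensor3_congruence.R_sum_mset_zero triple_zero)
next
  case 2 show ?case
    by (unfold case_prod_conv, rule tensor3_congruence.R_sum_mset_add)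
      (simp only: split_paired_all case_prod_conv distrib_right triple_add1)
next
  case 3 show ?case
    by (unfold case_prod_conv, rule tensor3_congruence.R_sum_mset_add)
      (simp only: split_paired_all case_prod_conv distrib_right triple_add2)
next
  case 4 show ?case
    by (unfold case_prod_conv, rule tensor3_congruence.R_sum_mset_add)
      (simp only: split_paired_all case_prod_conv distrib_right triple_add3)
next
  case 5 show ?case
    by (unfold case_prod_conv, rule tensor3_congruence.R_sum_mset)
      (simp only: split_paired_all case_prod_conv s_mult_left tensor3_scale12)
next
  case 6 show ?case
    by (unfold case_prod_conv, rule tensor3_congruence.R_sum_mset)
      (simp only: split_paired_all case_prod_conv s_mult_left tensor3_scale23)
qed

lemma mult3_right:
  assumes "tensor3_rel s N N'"
  shows "tensor3_rel s (mult3 M N) (mult3 M N')"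
  unfolding mult3_def
proof (rule tensor3_congruence.R_sum_mset, clarify, goal_cases)
  case (1 x y z)
  show ?case
  proof (rule tensor3_congruence.tensor3_lift[OF assms], goal_cases)
    case 5 show ?case
      using tensor3_scale12 by (simp add: s_mult_right)
  next
    case 6 show ?case
      using tensor3_scale23 by (simp add: s_mult_right)
  qed (simp_all only: case_prod_conv distrib_left mult_zero_right triple_zero triple_add1
      triple_add2 triple_add3)
qed

lemma mult3_cong:
  "tensor3_rel s M M' \<Longrightarrow> tensor3_rel s N N' \<Longrightarrow> tensor3_rel s (mult3 M N) (mult3 M' N')"
  using mult3_left mult3_right tensor3_trans by blast

lemma uminus2_cong: "tensor2_rel s M N \<Longrightarrow> tensor2_rel s (uminus2 M) (uminus2 N)"
  unfolding uminus2_def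
proof (erule tensor2_congruence.tensor2_lift, goal_cases)
  case 4 show ?case
    by (simp flip: s_uminus add: tensor2_scale12)
qed (simp_all only: case_prod_conv minus_add_distrib minus_zero pair_zero pair_add1 pair_add2)

lemma uminus3_cong: "tensor3_rel s M N \<Longrightarrow> tensor3_rel s (uminus3 M) (uminus3 N)"
  unfolding uminus3_def
proof (erule tensor3_congruence.tensor3_lift, goal_cases)
  case 5 show ?case
    by (simp flip: s_uminus add: tensor3_scale12)
next
  case 6 show ?case
    by (simp add: tensor3_scale23)
qed (simp_all only: case_prod_conv minus_add_distrib minus_zero triple_zero triple_add1
    triple_add2 triple_add3)

lemma scale2_cong: "tensor2_rel s M N \<Longrightarrow> tensor2_rel s (scale2 s c M) (scale2 s c N)"
  unfolding scale2_def
proof (erule tensor2_congruence.tensor2_lift, goal_cases)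
  case (4 d x y)
  have "s c (s d x) = s d (s c x)"
    by (simp add: s_s mult.commute)
  then show ?case
    by (simp add: tensor2_scale12)
qed (simp_all only: case_prod_conv s_add s_zero pair_zero pair_add1 pair_add2)

lemma uminus2_left: "tensor2_rel s (uminus2 M + M) {#}"
proof (induction M)
  case (add p M)
  obtain x y where p: "p = (x, y)" by (cases p)
  have "tensor2_rel s ({#(- x, y)#} + {#(x, y)#}) {#(- x + x, y)#}"
    by (rule tensor2_sym, rule pair_add1)
  also have "tensor2_rel s {#(- x + x, y)#} {#}"
    by (simp add: tensor2_zero)
  finally have "tensor2_rel s (({#(- x, y)#} + {#(x, y)#}) + (uminus2 M + M)) ({#} + {#})"
    by (rule tensor2_congruence.R_add) (rule add.IH)
  then show ?case
    by (simp add: p uminus2_def add_mset_commute)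
qed (simp add: uminus2_def tensor2_refl)

lemma uminus3_left: "tensor3_rel s (uminus3 M + M) {#}"
proof (induction M)
  case (add p M)
  obtain x y z where p: "p = (x, y, z)" by (cases p)
  have "tensor3_rel s ({#(- x, y, z)#} + {#(x, y, z)#}) {#(- x + x, y, z)#}"
    by (rule tensor3_sym, rule triple_add1)
  also have "tensor3_rel s {#(- x + x, y, z)#} {#}"
    by (simp add: tensor3_zero)
  finally have "tensor3_rel s (({#(- x, y, z)#} + {#(x, y, z)#}) + (uminus3 M + M)) ({#} + {#})"
    by (rule tensor3_congruence.R_add) (rule add.IH)
  then show ?case
    by (simp add: p uminus3_def add_mset_commute)
qed (simp add: uminus3_def tensor3_refl)

lemma not_tensor2_rel_0_1:
  fixes e :: "'v \<Rightarrow> 'k"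
  assumes "\<And>x y. e (x + y) = e x + e y" "\<And>c x. e (s c x) = c * e x" "e 1 = 1"
  shows "\<not> tensor2_rel s {#} {#(1, 1)#}"
proof
  have e0: "e 0 = 0"
    using assms(2)[of 0 0] by simp
  assume "tensor2_rel s {#} {#(1, 1)#}"
  then have "(\<Sum>(x, y)\<in>#{#}. e x * e y) = (\<Sum>(x, y)\<in>#{#(1, 1)#}. e x * e y)"
    by (rule eq_congruence.tensor2_lift) (simp_all add: assms e0 algebra_simps)
  then show False
    by (simp add: assms)
qed

lemma not_tensor3_rel_0_1:
  fixes e :: "'v \<Rightarrow> 'k"
  assumes "\<And>x y. e (x + y) = e x + e y" "\<And>c x. e (s c x) = c * e x" "e 1 = 1"
  shows "\<not> tensor3_rel s {#} {#(1, 1, 1)#}"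
proof
  have e0: "e 0 = 0"
    using assms(2)[of 0 0] by simp
  assume "tensor3_rel s {#} {#(1, 1, 1)#}"
  then have "(\<Sum>(x, y, z)\<in>#{#}. e x * e y * e z) = (\<Sum>(x, y, z)\<in>#{#(1, 1, 1)#}. e x * e y * e z)"
    by (rule eq_congruence.tensor3_lift) (simp_all add: assms e0 algebra_simps)
  then show False
    by (simp add: assms)
qed

end

interpretation sphere_alg: scaled_ring sph_scale
proof
  fix c d :: "'k::field" and x y :: "'k sphere_alg"
  show "sph_scale c (x + y) = sph_scale c x + sph_scale c y"
    by (simp only: sph_scale_def distrib_left)
  show "sph_scale c x * y = sph_scale c (x * y)"
    by (simp only: sph_scale_def mult.assoc)
  show "x * sph_scale c y = sph_scale c (x * y)"
    by (simp only: sph_scale_def mult.left_commute)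
  show "sph_scale c (sph_scale d x) = sph_scale (c * d) x"
    by (simp only: sph_scale_def ring_morphism.h_mult[OF ring_morphism_sph_const] mult.assoc)
qed

quotient_type (overloaded) 'k sphere2 = "('k::field sphere_alg \<times> 'k sphere_alg) multiset" / "tensor2_rel sph_scale"
  by (rule equivp_tensor2_rel)

instantiation sphere2 :: (field) comm_ring_1
begin

lift_definition zero_sphere2 :: "'a sphere2" is "{#}" .
lift_definition one_sphere2 :: "'a sphere2" is "{#(1, 1)#}" .
lift_definition plus_sphere2 :: "'a sphere2 \<Rightarrow> 'a sphere2 \<Rightarrow> 'a sphere2" is "(+)"
  by (rule tensor2_congruence.R_add)
lift_definition uminus_sphere2 :: "'a sphere2 \<Rightarrow> 'a sphere2" is uminus2
  by (rule sphere_alg.uminus2_cong)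
definition minus_sphere2 :: "'a sphere2 \<Rightarrow> 'a sphere2 \<Rightarrow> 'a sphere2" where
  "minus_sphere2 x y = x + - y"
lift_definition times_sphere2 :: "'a sphere2 \<Rightarrow> 'a sphere2 \<Rightarrow> 'a sphere2" is mult2
  by (rule sphere_alg.mult2_cong)

instance
proof
  fix a b c :: "'a sphere2"
  obtain p q r where "a = abs_sphere2 p" "b = abs_sphere2 q" "c = abs_sphere2 r"
    by (metis Quotient3_abs_rep[OF Quotient3_sphere2])
  then show "a + b + c = a + (b + c)" "a + b = b + a" "0 + a = a" "a - b = a + - b"
    "a * b * c = a * (b * c)" "a * b = b * a" "1 * a = a" "(a + b) * c = a * c + b * c" "- a + a = 0"
    by (simp_all only: zero_sphere2_def one_sphere2_def plus_sphere2.abs_eq uminus_sphere2.abs_eq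
      minus_sphere2_def times_sphere2.abs_eq add.assoc add.commute[of q p] add_0_left
      mult2_assoc mult2_one mult2_simps mult2_commute[of q p] sphere2.abs_eq_iff
      sphere_alg.uminus2_left tensor2_refl empty_neutral)
  have "\<not> tensor2_rel sph_scale {#} {#(1 :: 'a sphere_alg, 1)#}"
    by (rule sphere_alg.not_tensor2_rel_0_1[of sph_counit])
      (simp_all add: sph_scale_def ring_morphism.h_add[OF ring_morphism_sph_counit]
        ring_morphism.h_mult[OF ring_morphism_sph_counit]
        ring_morphism.h_one[OF ring_morphism_sph_counit])
  then show "(0 :: 'a sphere2) \<noteq> 1"
    by (simp add: zero_sphere2_def one_sphere2_def sphere2.abs_eq_iff)
qed

end

definition sph_tensor :: "'k::field sphere_alg \<Rightarrow> 'k sphere_alg \<Rightarrow> 'k sphere2" where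
  "sph_tensor x y = abs_sphere2 {#(x, y)#}"

lemma sph_tensor_add1: "sph_tensor (x + x') y = sph_tensor x y + sph_tensor x' y"
  by (simp only: sph_tensor_def plus_sphere2.abs_eq sphere2.abs_eq_iff sphere_alg.pair_add1)

lemma sph_tensor_add2: "sph_tensor x (y + y') = sph_tensor x y + sph_tensor x y'"
  by (simp only: sph_tensor_def plus_sphere2.abs_eq sphere2.abs_eq_iff sphere_alg.pair_add2)

lemma sph_tensor_mult: "sph_tensor x y * sph_tensor x' y' = sph_tensor (x * x') (y * y')"
  by (simp add: sph_tensor_def times_sphere2.abs_eq)

lemma sph_tensor_one: "sph_tensor 1 1 = 1"
  by (simp add: sph_tensor_def one_sphere2_def)

lemma sph_tensor_zero1 [simp]: "sph_tensor 0 y = 0"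
  using sph_tensor_add1[of 0 0 y] by simp

lemma sph_tensor_zero2 [simp]: "sph_tensor y 0 = 0"
  using sph_tensor_add2[of y 0 0] by simp

lemma sph_tensor_sum1: "sph_tensor (sum f A) y = (\<Sum>a\<in>A. sph_tensor (f a) y)"
  by (induction A rule: infinite_finite_induct) (simp_all add: sph_tensor_add1)

lemma sph_tensor_sum2: "sph_tensor y (sum f A) = (\<Sum>a\<in>A. sph_tensor y (f a))"
  by (induction A rule: infinite_finite_induct) (simp_all add: sph_tensor_add2)

lemma ring_morphism_const_tensor: "ring_morphism (\<lambda>c. sph_tensor (sph_const c) 1)"
proof -
  interpret c: ring_morphism sph_const by (rule ring_morphism_sph_const)
  show ?thesis
    by unfold_locales
      (simp_all add: c.h_add c.h_mult c.h_one sph_tensor_add1 sph_tensor_mult sph_tensor_one)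
qed

definition gen_coproduct :: "Z23 \<Rightarrow> 'k::field sphere2" where
  "gen_coproduct c = (\<Sum>(a, b) | a + b = c. cochain a b * sph_tensor (f_gen a) (f_gen b))"

lemma sum_add_eq:
  "(\<Sum>(a, b) | a + b = c. g a b) = (\<Sum>a\<in>UNIV. g a (a + (c :: Z23)))"
  by (rule sum.reindex_bij_witness[of _ "\<lambda>a. (a, a + c)" fst]) auto

lemma sum_shift: "(\<Sum>a\<in>UNIV. g (a + d)) = (\<Sum>a\<in>UNIV. g (a :: Z23))"
  by (rule sum.reindex_bij_witness[of _ "\<lambda>a. a + d" "\<lambda>a. a + d"]) (auto simp: add.assoc)

lemma sum_cancel:
  fixes g :: "Z23 \<Rightarrow> 'a::ab_group_add"
  assumes d: "d \<noteq> 0" and g: "\<And>a. g (a + d) = - g a"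
  shows "(\<Sum>a\<in>UNIV. g a) = 0"
proof -
  obtain i where i: "d $ i = 1"
    using d by (auto simp: vec_eq_iff)
  have U: "UNIV = {a :: Z23. a $ i = 0} \<union> {a. a $ i = 1}"
    by auto
  have "(\<Sum>a | a $ i = 1. g a) = (\<Sum>a | a $ i = 0. g (a + d))"
    by (rule sum.reindex_bij_witness[of _ "\<lambda>a. a + d" "\<lambda>a. a + d"]) (auto simp: add.assoc i)
  then have "(\<Sum>a | a $ i = 0. g a) + (\<Sum>a | a $ i = 1. g a) = 0"
    by (simp add: g sum_negf)
  then show ?thesis
    unfolding U by (subst sum.union_disjoint) auto
qed

lemma cochain_exponent_add2: "cochain_exponent a (b + c) = cochain_exponent a b + cochain_exponent a c"
  by (simp only: cochain_exponent_def vector_add_component distrib_left distrib_right add_ac)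

lemma cochain_exponent_shift:
  assumes "d \<noteq> 0"
  shows "cochain_exponent a d + cochain_exponent (a + d) d = 1"
proof -
  have "d$1 = 1 \<or> d$2 = 1 \<or> d$3 = 1"
    using assms by (auto simp: vec_eq_iff forall_3)
  then show ?thesis
    unfolding cochain_exponent_def vector_add_component
    by (cases "a$1"; cases "a$2"; cases "a$3"; cases "d$1"; cases "d$2"; cases "d$3") simp_all
qed

lemma cochain_shift:
  assumes "d \<noteq> 0"
  shows "cochain a (b + d) * cochain (a + d) b =
    - (cochain a b * cochain (a + d) (b + d) :: 'a::ring_1)"
proof -
  have sign: "minus_one_pow (p + q + r) = - (minus_one_pow (p + (r + s)) :: 'a)" if "q + s = 1"
    for p q r s
    using that by (cases p; cases q; cases r; cases s) simp_all
  show ?thesis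
    unfolding cochain_def minus_one_pow_add[symmetric] cochain_exponent_add2
    by (rule sign[OF cochain_exponent_shift[OF assms]])
qed

lemma cochain_square: "cochain a b * cochain a b = (1 :: 'a::ring_1)"
  using minus_one_pow_square[of "cochain_exponent a b"] by (simp add: cochain_def power2_eq_square)

lemma sum_gen_coproduct_square: "(\<Sum>c\<in>UNIV. (gen_coproduct c)\<^sup>2) = (1 :: 'k::field sphere2)"
proof -
  define T :: "Z23 \<Rightarrow> Z23 \<Rightarrow> Z23 \<Rightarrow> Z23 \<Rightarrow> 'k sphere2"
    where "T a b a' b' = cochain a b * cochain a' b' *
      sph_tensor (f_gen a * f_gen a') (f_gen b * f_gen b')" for a b a' b'
  have T: "(\<Sum>b\<in>UNIV. T a b (a + d) (b + d)) = 0" if "d \<noteq> 0" for a d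
  proof (rule sum_cancel[OF that])
    fix b
    show "T a (b + d) (a + d) (b + d + d) = - T a b (a + d) (b + d)"
      using cochain_shift[OF that, of a b, where 'a = "'k sphere2"]
      by (simp add: T_def add.assoc mult.commute[of "f_gen (b + d)"])
  qed
  have "(gen_coproduct c)\<^sup>2 = (\<Sum>a\<in>UNIV. \<Sum>a'\<in>UNIV. T a (a + c) a' (a' + c))" for c
    by (simp add: gen_coproduct_def sum_add_eq power2_eq_square sum_product T_def mult_ac
        flip: sph_tensor_mult)
  then have "(\<Sum>c\<in>UNIV. (gen_coproduct c)\<^sup>2) =
      (\<Sum>c\<in>UNIV. \<Sum>a\<in>UNIV. \<Sum>a'\<in>UNIV. T a (a + c) a' (a' + c))"
    by simp
  also have "\<dots> = (\<Sum>a\<in>UNIV. \<Sum>c\<in>UNIV. \<Sum>a'\<in>UNIV. T a (a + c) a' (a' + c))"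
    by (rule sum.swap)
  also have "\<dots> = (\<Sum>a\<in>UNIV. \<Sum>b\<in>UNIV. \<Sum>a'\<in>UNIV. T a (a + (b + a)) a' (a' + (b + a)))"
    by (simp only: sum_shift[where g = "\<lambda>c. \<Sum>a'\<in>UNIV. T a (a + c) a' (a' + c)" for a])
  also have "\<dots> = (\<Sum>a\<in>UNIV. \<Sum>b\<in>UNIV. \<Sum>d\<in>UNIV. T a b (a + d) (b + d))"
  proof (rule sum.cong[OF refl], rule sum.cong[OF refl], goal_cases)
    case (1 a b)
    have "(\<Sum>a'\<in>UNIV. T a (a + (b + a)) a' (a' + (b + a))) =
      (\<Sum>d\<in>UNIV. T a (a + (b + a)) (d + a) (d + a + (b + a)))"
      by (rule sum_shift[symmetric])
    moreover have "T a (a + (b + a)) (d + a) (d + a + (b + a)) = T a b (a + d) (b + d)" for d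
    proof -
      have *: "a + (b + a) = b" "d + a + (b + a) = b + d" "d + a = a + d"
        by (metis Z23_add_cancel add.commute add.left_commute)+
      show ?thesis
        unfolding *(1,2) unfolding *(3) by (rule refl)
    qed
    ultimately show ?case
      by (simp only:)
  qed
  also have "\<dots> = (\<Sum>a\<in>UNIV. \<Sum>d\<in>UNIV. \<Sum>b\<in>UNIV. T a b (a + d) (b + d))"
    by (intro sum.cong refl sum.swap)
  also have "\<dots> = (\<Sum>a\<in>UNIV. \<Sum>d\<in>UNIV. if d = (0 :: Z23) then \<Sum>b\<in>UNIV. T a b a b else 0)"
    by (rule sum.cong[OF refl], rule sum.cong[OF refl]) (auto simp: T)
  also have "\<dots> = (\<Sum>a\<in>UNIV. \<Sum>b\<in>UNIV. sph_tensor ((f_gen a)\<^sup>2) ((f_gen b)\<^sup>2))"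
    by (simp add: T_def cochain_square power2_eq_square)
  also have "\<dots> = sph_tensor (\<Sum>a\<in>UNIV. (f_gen a)\<^sup>2) (\<Sum>b\<in>UNIV. (f_gen b)\<^sup>2)"
    by (simp add: sph_tensor_sum1 sph_tensor_sum2) (rule sum.swap)
  also have "\<dots> = 1"
    by (simp only: sphere_relation sph_tensor_one)
  finally show ?thesis .
qed

lift_definition sph_coproduct :: "'k::field sphere_alg \<Rightarrow> 'k sphere2"
  is "peval (\<lambda>c. sph_tensor (sph_const c) 1) gen_coproduct"
  by (rule sphere_rel_respects[OF ring_morphism_const_tensor sum_gen_coproduct_square])

lemma sph_coproduct_gen: "sph_coproduct (f_gen c) = gen_coproduct c"
  by (simp add: f_gen.abs_eq sph_coproduct.abs_eq peval_var[OF ring_morphism_const_tensor])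

lemma sph_coproduct_const: "sph_coproduct (sph_const c) = sph_tensor (sph_const c) 1"
proof -
  have "sph_coproduct (sph_const c) = sph_coproduct (abs_sphere_alg (Poly_Mapping.single 0 c))"
    by (simp only: sph_const.abs_eq)
  also have "\<dots> = sph_tensor (sph_const c) 1"
    by (simp only: sph_coproduct.abs_eq peval_single[OF ring_morphism_const_tensor]) simp
  finally show ?thesis .
qed

lemma ring_morphism_sph_coproduct: "ring_morphism (sph_coproduct :: 'k::field sphere_alg \<Rightarrow> _)"
proof -
  interpret e: ring_morphism "peval (\<lambda>c::'k. sph_tensor (sph_const c) 1) gen_coproduct"
    by (rule ring_morphism_peval[OF ring_morphism_const_tensor])
  have "sph_coproduct (x + y) = sph_coproduct x + sph_coproduct y"
    "sph_coproduct (x * y) = sph_coproduct x * sph_coproduct y" for x y :: "'k sphere_alg"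
  proof -
    obtain p q where "x = abs_sphere_alg p" "y = abs_sphere_alg q"
      by (metis Quotient3_abs_rep[OF Quotient3_sphere_alg])
    then show "sph_coproduct (x + y) = sph_coproduct x + sph_coproduct y"
      "sph_coproduct (x * y) = sph_coproduct x * sph_coproduct y"
      by (simp_all add: plus_sphere_alg.abs_eq times_sphere_alg.abs_eq sph_coproduct.abs_eq
          e.h_add e.h_mult)
  qed
  moreover have "sph_coproduct (1 :: 'k sphere_alg) = 1"
    using e.h_one by (simp only: sph_coproduct.abs_eq flip: one_sphere_alg_def sph_coproduct.abs_eq)
  ultimately show ?thesis
    by (simp add: ring_morphism_def)
qed

section \<open>The cross product and its coproduct\<close>

text \<open>An element \<open>\<Sum>\<^sub>u f\<^sub>u \<otimes> \<sigma>\<^sub>u\<close> of the tensor product of the sphere algebra with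
  the group algebra is given by its coefficients f, a function of u.\<close>

typedef (overloaded) 'k crossed = "UNIV :: (Z23 \<Rightarrow> 'k::field sphere_alg) set"
  morphisms crossed_coeff Abs_crossed ..

setup_lifting type_definition_crossed

instantiation crossed :: (field) ring_1
begin

lift_definition zero_crossed :: "'a crossed" is "\<lambda>_. 0" .
lift_definition one_crossed :: "'a crossed" is "\<lambda>u. if u = 0 then 1 else 0" .
lift_definition plus_crossed :: "'a crossed \<Rightarrow> 'a crossed \<Rightarrow> 'a crossed" is "\<lambda>f g u. f u + g u" .
lift_definition minus_crossed :: "'a crossed \<Rightarrow> 'a crossed \<Rightarrow> 'a crossed" is "\<lambda>f g u. f u - g u" .
lift_definition uminus_crossed :: "'a crossed \<Rightarrow> 'a crossed" is "\<lambda>f u. - f u" .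
lift_definition times_crossed :: "'a crossed \<Rightarrow> 'a crossed \<Rightarrow> 'a crossed"
  is "\<lambda>f g w. \<Sum>(u, v) | u + v = w. f u * sph_act u (g v)" .

instance
proof
  fix a b c :: "'a crossed"
  show "a * b * c = a * (b * c)"
  proof (transfer, rule ext)
    fix f g h :: "Z23 \<Rightarrow> 'a sphere_alg" and w
    have "(\<Sum>v\<in>UNIV. (\<Sum>u\<in>UNIV. f u * sph_act u (g (u + v))) * sph_act v (h (v + w))) =
      (\<Sum>v\<in>UNIV. \<Sum>u\<in>UNIV. f u * sph_act u (g (u + v)) * sph_act v (h (v + w)))"
      by (simp add: sum_distrib_right)
    also have "\<dots> = (\<Sum>u\<in>UNIV. \<Sum>v\<in>UNIV. f u * sph_act u (g (u + v)) * sph_act v (h (v + w)))"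
      by (rule sum.swap)
    also have "\<dots> = (\<Sum>u\<in>UNIV. \<Sum>v\<in>UNIV. f u * sph_act u (g (u + (v + u))) * sph_act (v + u) (h (v + u + w)))"
      by (simp only: sum_shift[where g = "\<lambda>v. f u * sph_act u (g (u + v)) * sph_act v (h (v + w))" for u])
    also have "\<dots> = (\<Sum>u\<in>UNIV. \<Sum>v\<in>UNIV. f u * sph_act u (g v) * sph_act u (sph_act v (h (v + (u + w)))))"
      by (simp add: sph_act_act add_ac)
    also have "\<dots> = (\<Sum>u\<in>UNIV. f u * sph_act u (\<Sum>v\<in>UNIV. g v * sph_act v (h (v + (u + w)))))"
      by (simp add: ring_morphism.h_sum[OF ring_morphism_sph_act]
          ring_morphism.h_mult[OF ring_morphism_sph_act] sum_distrib_left mult_ac)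
    finally show "(\<Sum>(v, v') | v + v' = w. (\<Sum>(u, u') | u + u' = v. f u * sph_act u (g u')) * sph_act v (h v')) =
      (\<Sum>(u, u') | u + u' = w. f u * sph_act u (\<Sum>(v, v') | v + v' = u'. g v * sph_act v (h v')))"
      by (simp add: sum_add_eq)
  qed
  show "1 * a = a"
  proof (transfer, rule ext)
    fix f :: "Z23 \<Rightarrow> 'a sphere_alg" and w
    have "(if u = 0 then 1 else 0) * sph_act u (f (u + w)) = (if u = 0 then f w else 0)" for u
      by simp
    then show "(\<Sum>(u, v) | u + v = w. (if u = 0 then 1 else 0) * sph_act u (f v)) = f w"
      by (simp add: sum_add_eq)
  qed
  show "a * 1 = a"
  proof (transfer, rule ext)
    fix f :: "Z23 \<Rightarrow> 'a sphere_alg" and w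
    have "f u * sph_act u (if u + w = 0 then 1 else 0) = (if u = w then f u else 0)" for u
      using ring_morphism.h_one[OF ring_morphism_sph_act[of u, where 'k = 'a]]
        ring_morphism.h_zero[OF ring_morphism_sph_act[of u, where 'k = 'a]]
      by (auto dest: Z23_add_eq_0)
    then show "(\<Sum>(u, v) | u + v = w. f u * sph_act u (if v = 0 then 1 else 0)) = f w"
      by (simp add: sum_add_eq)
  qed
  show "(a + b) * c = a * c + b * c"
    by transfer (simp only: sum_add_eq distrib_right sum.distrib)
  show "a * (b + c) = a * b + a * c"
    by transfer (simp only: sum_add_eq distrib_left sum.distrib
        ring_morphism.h_add[OF ring_morphism_sph_act])
  show "(0 :: 'a crossed) \<noteq> 1"
  proof
    assume "(0 :: 'a crossed) = 1"
    then have "crossed_coeff (0 :: 'a crossed) 0 = crossed_coeff 1 0"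
      by (rule arg_cong)
    then show False
      by (simp add: zero_crossed.rep_eq one_crossed.rep_eq)
  qed
qed (transfer; simp add: add_ac)+

end

lift_definition crossed_scale :: "'k::field \<Rightarrow> 'k crossed \<Rightarrow> 'k crossed"
  is "\<lambda>c f u. sph_scale c (f u)" .

text \<open>The pure tensor \<open>f \<otimes> \<sigma>\<^sub>u\<close>.\<close>

definition smash :: "'k::field sphere_alg \<Rightarrow> Z23 \<Rightarrow> 'k crossed" where
  "smash f u = Abs_crossed (\<lambda>v. if v = u then f else 0)"

definition T_one :: "Z23 \<Rightarrow> 'k::field crossed" where
  "T_one u = smash 1 u"

definition T_gen :: "Z23 \<Rightarrow> Z23 \<Rightarrow> 'k::field crossed" where
  "T_gen c u = smash (f_gen c) u"

lift_definition crossed_counit :: "'k::field crossed \<Rightarrow> 'k"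
  is "\<lambda>f. \<Sum>u\<in>UNIV. sph_counit (f u)" .

lemma coeff_eqI: "(\<And>u. crossed_coeff x u = crossed_coeff y u) \<Longrightarrow> x = y"
  by (simp add: fun_eq_iff flip: crossed_coeff_inject)

interpretation crossed: scaled_ring crossed_scale
proof
  fix c d :: "'k::field" and x y :: "'k crossed"
  note rep_eqs = times_crossed.rep_eq plus_crossed.rep_eq crossed_scale.rep_eq sum_add_eq
  show "crossed_scale c x * y = crossed_scale c (x * y)"
    by (rule coeff_eqI) (simp only: rep_eqs sphere_alg.s_mult_left sph_scale_def sum_distrib_left mult.assoc)
  have "sph_act u (sph_scale c z) = sph_scale c (sph_act u z)" for u and z :: "'k sphere_alg"
    by (simp add: sph_scale_def ring_morphism.h_mult[OF ring_morphism_sph_act])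
  then show "x * crossed_scale c y = crossed_scale c (x * y)"
    by (intro coeff_eqI)
      (simp only: rep_eqs sphere_alg.s_mult_right sph_scale_def sum_distrib_left mult.left_commute)
  show "crossed_scale c (x + y) = crossed_scale c x + crossed_scale c y"
    by (rule coeff_eqI) (simp only: rep_eqs sphere_alg.s_add)
  show "crossed_scale c (crossed_scale d x) = crossed_scale (c * d) x"
    by (rule coeff_eqI) (simp only: rep_eqs sphere_alg.s_s)
qed

lemma crossed_coeff_smash: "crossed_coeff (smash f u) v = (if v = u then f else 0)"
  by (simp add: smash_def Abs_crossed_inverse)

lemma smash_add: "smash (f + g) u = smash f u + smash g u"
  by (rule coeff_eqI) (simp add: crossed_coeff_smash plus_crossed.rep_eq)

lemma smash_zero [simp]: "smash 0 u = 0"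
  by (rule coeff_eqI) (simp add: crossed_coeff_smash zero_crossed.rep_eq)

lemma smash_scale: "smash (sph_scale c f) u = crossed_scale c (smash f u)"
  by (rule coeff_eqI) (simp add: crossed_coeff_smash crossed_scale.rep_eq sph_scale_def)

lemma smash_mult: "smash f u * smash g v = smash (f * sph_act u g) (u + v)"
proof (rule coeff_eqI)
  fix w
  have "(if a = u then f else 0) * sph_act a (if a + w = v then g else 0) =
      (if a = u then if w = u + v then f * sph_act u g else 0 else 0)" for a
  proof -
    have "u + w = v \<longleftrightarrow> w = u + v"
      by (metis Z23_add_cancel)
    then show ?thesis
      using ring_morphism.h_zero[OF ring_morphism_sph_act[of u, where 'k = 'a]] by auto
  qed
  then show "crossed_coeff (smash f u * smash g v) w = crossed_coeff (smash (f * sph_act u g) (u + v)) w"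
    by (simp add: times_crossed.rep_eq crossed_coeff_smash sum_add_eq)
qed

lemma one_crossed_eq: "1 = smash 1 0"
  by (rule coeff_eqI) (simp add: crossed_coeff_smash one_crossed.rep_eq)

lemma T_one_mult: "T_one u * T_one v = T_one (u + v)"
  by (simp add: T_one_def smash_mult ring_morphism.h_one[OF ring_morphism_sph_act])

lemma crossed_counit_smash: "crossed_counit (smash f u) = sph_counit f"
proof -
  have "sph_counit (if v = u then f else 0) = (if v = u then sph_counit f else 0)" for v
    by (simp add: ring_morphism.h_zero[OF ring_morphism_sph_counit])
  then show ?thesis
    by (simp add: crossed_counit.rep_eq crossed_coeff_smash)
qed

lemma crossed_counit_add: "crossed_counit (x + y) = crossed_counit x + crossed_counit y"
  by (simp add: crossed_counit.rep_eq plus_crossed.rep_eq sum.distrib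
      ring_morphism.h_add[OF ring_morphism_sph_counit])

lemma crossed_counit_scale: "crossed_counit (crossed_scale c x) = c * crossed_counit x"
  by (simp add: crossed_counit.rep_eq crossed_scale.rep_eq sph_scale_def sum_distrib_left
      ring_morphism.h_mult[OF ring_morphism_sph_counit])

lemma crossed_counit_one: "crossed_counit 1 = 1"
  by (simp add: one_crossed_eq crossed_counit_smash ring_morphism.h_one[OF ring_morphism_sph_counit])

quotient_type (overloaded) 'k crossed2 =
  "('k::field crossed \<times> 'k crossed) multiset" / "tensor2_rel crossed_scale"
  by (rule equivp_tensor2_rel)

instantiation crossed2 :: (field) ring_1
begin

lift_definition zero_crossed2 :: "'a crossed2" is "{#}" .
lift_definition one_crossed2 :: "'a crossed2" is "{#(1, 1)#}" .
lift_definition plus_crossed2 :: "'a crossed2 \<Rightarrow> 'a crossed2 \<Rightarrow> 'a crossed2" is "(+)"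
  by (rule tensor2_congruence.R_add)
lift_definition uminus_crossed2 :: "'a crossed2 \<Rightarrow> 'a crossed2" is uminus2
  by (rule crossed.uminus2_cong)
definition minus_crossed2 :: "'a crossed2 \<Rightarrow> 'a crossed2 \<Rightarrow> 'a crossed2" where
  "minus_crossed2 x y = x + - y"
lift_definition times_crossed2 :: "'a crossed2 \<Rightarrow> 'a crossed2 \<Rightarrow> 'a crossed2" is mult2
  by (rule crossed.mult2_cong)

instance
proof
  fix a b c :: "'a crossed2"
  obtain p q r where "a = abs_crossed2 p" "b = abs_crossed2 q" "c = abs_crossed2 r"
    by (metis Quotient3_abs_rep[OF Quotient3_crossed2])
  then show "a + b + c = a + (b + c)" "a + b = b + a" "0 + a = a" "a - b = a + - b"
    "a * b * c = a * (b * c)" "1 * a = a" "a * 1 = a" "(a + b) * c = a * c + b * c"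
    "a * (b + c) = a * b + a * c" "- a + a = 0"
    by (simp_all only: zero_crossed2_def one_crossed2_def plus_crossed2.abs_eq
      uminus_crossed2.abs_eq minus_crossed2_def times_crossed2.abs_eq add.assoc add.commute[of q p]
      add_0_left mult2_assoc mult2_one mult2_simps crossed2.abs_eq_iff
      crossed.uminus2_left tensor2_refl empty_neutral)
  have "\<not> tensor2_rel crossed_scale {#} {#(1 :: 'a crossed, 1)#}"
    by (rule crossed.not_tensor2_rel_0_1[of crossed_counit])
      (simp_all only: crossed_counit_add crossed_counit_scale crossed_counit_one)
  then show "(0 :: 'a crossed2) \<noteq> 1"
    by (simp add: zero_crossed2_def one_crossed2_def crossed2.abs_eq_iff)
qed

end

quotient_type (overloaded) 'k crossed3 =
  "('k::field crossed \<times> 'k crossed \<times> 'k crossed) multiset" / "tensor3_rel crossed_scale"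
  by (rule equivp_tensor3_rel)

instantiation crossed3 :: (field) ring_1
begin

lift_definition zero_crossed3 :: "'a crossed3" is "{#}" .
lift_definition one_crossed3 :: "'a crossed3" is "{#(1, 1, 1)#}" .
lift_definition plus_crossed3 :: "'a crossed3 \<Rightarrow> 'a crossed3 \<Rightarrow> 'a crossed3" is "(+)"
  by (rule tensor3_congruence.R_add)
lift_definition uminus_crossed3 :: "'a crossed3 \<Rightarrow> 'a crossed3" is uminus3
  by (rule crossed.uminus3_cong)
definition minus_crossed3 :: "'a crossed3 \<Rightarrow> 'a crossed3 \<Rightarrow> 'a crossed3" where
  "minus_crossed3 x y = x + - y"
lift_definition times_crossed3 :: "'a crossed3 \<Rightarrow> 'a crossed3 \<Rightarrow> 'a crossed3" is mult3
  by (rule crossed.mult3_cong)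

instance
proof
  fix a b c :: "'a crossed3"
  obtain p q r where "a = abs_crossed3 p" "b = abs_crossed3 q" "c = abs_crossed3 r"
    by (metis Quotient3_abs_rep[OF Quotient3_crossed3])
  then show "a + b + c = a + (b + c)" "a + b = b + a" "0 + a = a" "a - b = a + - b"
    "a * b * c = a * (b * c)" "1 * a = a" "a * 1 = a" "(a + b) * c = a * c + b * c"
    "a * (b + c) = a * b + a * c" "- a + a = 0"
    by (simp_all only: zero_crossed3_def one_crossed3_def plus_crossed3.abs_eq
      uminus_crossed3.abs_eq minus_crossed3_def times_crossed3.abs_eq add.assoc add.commute[of q p]
      add_0_left mult3_assoc mult3_one mult3_simps crossed3.abs_eq_iff
      crossed.uminus3_left tensor3_refl empty_neutral)
  have "\<not> tensor3_rel crossed_scale {#} {#(1 :: 'a crossed, 1, 1)#}"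
    by (rule crossed.not_tensor3_rel_0_1[of crossed_counit])
      (simp_all only: crossed_counit_add crossed_counit_scale crossed_counit_one)
  then show "(0 :: 'a crossed3) \<noteq> 1"
    by (simp add: zero_crossed3_def one_crossed3_def crossed3.abs_eq_iff)
qed

end

lifting_forget crossed.lifting

definition tensor :: "'k::field crossed \<Rightarrow> 'k crossed \<Rightarrow> 'k crossed2" (infix "\<otimes>\<^sub>D" 72) where
  "x \<otimes>\<^sub>D y = abs_crossed2 {#(x, y)#}"

text \<open>The two maps \<open>t \<otimes> z\<close> and \<open>x \<otimes> t\<close> for t in the twofold and x, z in the first tensor power.\<close>

lift_definition tensor_right :: "'k::field crossed2 \<Rightarrow> 'k crossed \<Rightarrow> 'k crossed3"
  is "\<lambda>M z. \<Sum>(x, y)\<in>#M. {#(x, y, z)#}"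
proof (erule tensor3_congruence.tensor2_lift, goal_cases)
  case 4 show ?case
    by (simp add: tensor3_scale12)
qed (simp_all only: case_prod_conv crossed.triple_zero crossed.triple_add1 crossed.triple_add2)

lift_definition tensor_left :: "'k::field crossed \<Rightarrow> 'k crossed2 \<Rightarrow> 'k crossed3"
  is "\<lambda>x M. \<Sum>(y, z)\<in>#M. {#(x, y, z)#}"
  by (erule tensor3_congruence.tensor2_lift)
    (simp_all only: case_prod_conv crossed.triple_zero2 crossed.triple_add2 crossed.triple_add3
      tensor3_scale23)

text \<open>The map \<open>f \<otimes> g \<mapsto> (f \<otimes> \<sigma>\<^sub>u) \<otimes> (g \<otimes> \<sigma>\<^sub>u)\<close>. Composed with the coproduct of the sphere algebra
  it gives the coproduct on the component of \<open>\<sigma>\<^sub>u\<close>, as \<open>\<sigma>\<^sub>u\<close> is group-like.\<close>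

lift_definition tensor_diag :: "Z23 \<Rightarrow> 'k::field sphere2 \<Rightarrow> 'k crossed2"
  is "\<lambda>u M. \<Sum>(f, g)\<in>#M. {#(smash f u, smash g u)#}"
  by (erule tensor2_congruence.tensor2_lift)
    (simp_all only: case_prod_conv smash_zero smash_add smash_scale crossed.pair_zero
      crossed.pair_add1 crossed.pair_add2 tensor2_scale12)

definition crossed_coproduct :: "'k::field crossed \<Rightarrow> 'k crossed2" where
  "crossed_coproduct x = (\<Sum>u\<in>UNIV. tensor_diag u (sph_coproduct (crossed_coeff x u)))"

lift_definition crossed2_scale :: "'k::field \<Rightarrow> 'k crossed2 \<Rightarrow> 'k crossed2"
  is "scale2 crossed_scale"
  by (rule crossed.scale2_cong)

lemma crossed2_cases:
  obtains p where "x = abs_crossed2 p"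
  by (metis Quotient3_abs_rep[OF Quotient3_crossed2])

lemma sphere2_cases:
  obtains p where "x = abs_sphere2 p"
  by (metis Quotient3_abs_rep[OF Quotient3_sphere2])

lemma crossed2_induct [case_names zero tensor add]:
  assumes "P 0" "\<And>x y. P (x \<otimes>\<^sub>D y)" "\<And>s t. P s \<Longrightarrow> P t \<Longrightarrow> P (s + t)"
  shows "P s"
proof (cases s rule: crossed2_cases)
  case (1 M)
  have "P (abs_crossed2 M)"
  proof (induction M rule: multiset_sum_induct)
    case empty
    then show ?case
      using assms(1) by (simp add: zero_crossed2_def)
  next
    case (single p)
    then show ?case
      using assms(2) by (cases p) (simp add: tensor_def)
  next
    case (union M N)
    then show ?case
      using assms(3) by (simp flip: plus_crossed2.abs_eq)
  qed
  then show ?thesis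
    by (simp add: 1)
qed

lemma sphere2_induct [case_names zero tensor add]:
  assumes "P 0" "\<And>x y. P (sph_tensor x y)" "\<And>s t. P s \<Longrightarrow> P t \<Longrightarrow> P (s + t)"
  shows "P s"
proof (cases s rule: sphere2_cases)
  case (1 M)
  have "P (abs_sphere2 M)"
  proof (induction M rule: multiset_sum_induct)
    case empty
    then show ?case
      using assms(1) by (simp add: zero_sphere2_def)
  next
    case (single p)
    then show ?case
      using assms(2) by (cases p) (simp add: sph_tensor_def)
  next
    case (union M N)
    then show ?case
      using assms(3) by (simp flip: plus_sphere2.abs_eq)
  qed
  then show ?thesis
    by (simp add: 1)
qed

lemma crossed2_scale_tensor: "crossed2_scale c (x \<otimes>\<^sub>D y) = crossed_scale c x \<otimes>\<^sub>D y"
  by (simp add: tensor_def crossed2_scale.abs_eq scale2_def)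

lemma tensor_right_tensor: "tensor_right (x \<otimes>\<^sub>D y) z = abs_crossed3 {#(x, y, z)#}"
  by (simp add: tensor_def tensor_right.abs_eq)

lemma tensor_left_tensor: "tensor_left x (y \<otimes>\<^sub>D z) = abs_crossed3 {#(x, y, z)#}"
  by (simp add: tensor_def tensor_left.abs_eq)

lemma tensor_diag_add: "tensor_diag u (s + t) = tensor_diag u s + tensor_diag u t"
  by (cases s rule: sphere2_cases; cases t rule: sphere2_cases)
    (simp add: plus_sphere2.abs_eq tensor_diag.abs_eq plus_crossed2.abs_eq)

lemma tensor_diag_zero [simp]: "tensor_diag u 0 = 0"
  using tensor_diag_add[of u 0 0] by simp

lemma tensor_diag_tensor: "tensor_diag u (sph_tensor f g) = smash f u \<otimes>\<^sub>D smash g u"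
  by (simp add: sph_tensor_def tensor_diag.abs_eq tensor_def)

lemma crossed2_scale_add: "crossed2_scale c (s + t) = crossed2_scale c s + crossed2_scale c t"
  by (cases s rule: crossed2_cases; cases t rule: crossed2_cases)
    (simp add: plus_crossed2.abs_eq crossed2_scale.abs_eq scale2_def)

lemma crossed2_scale_zero [simp]: "crossed2_scale c 0 = 0"
  using crossed2_scale_add[of c 0 0] by simp

lemma crossed2_scale_sum: "crossed2_scale c (sum f A) = (\<Sum>a\<in>A. crossed2_scale c (f a))"
  by (induction A rule: infinite_finite_induct) (simp_all add: crossed2_scale_add)

lemma tensor_diag_scale:
  "tensor_diag u (sph_tensor (sph_const c) 1 * s) = crossed2_scale c (tensor_diag u s)"
proof (induction s rule: sphere2_induct)
  case (tensor x y)
  show ?case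
    by (simp add: sph_tensor_mult tensor_diag_tensor crossed2_scale_tensor smash_scale
        flip: sph_scale_def)
qed (simp_all add: distrib_left tensor_diag_add crossed2_scale_add)

lemma tensor_diag_cochain: "tensor_diag u (cochain a b * s) = cochain a b * tensor_diag u s"
proof -
  have "tensor_diag u (- s) = - tensor_diag u s"
    using tensor_diag_add[of u s "- s"] by (simp add: eq_neg_iff_add_eq_0 add.commute)
  then show ?thesis
    by (simp add: cochain_def minus_one_pow_def)
qed

lemma tensor_diag_sum: "tensor_diag u (sum f A) = (\<Sum>a\<in>A. tensor_diag u (f a))"
  by (induction A rule: infinite_finite_induct) (simp_all add: tensor_diag_add)

lemma crossed_coproduct_add: "crossed_coproduct (x + y) = crossed_coproduct x + crossed_coproduct y"
  by (simp add: crossed_coproduct_def plus_crossed.rep_eq tensor_diag_add sum.distrib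
      ring_morphism.h_add[OF ring_morphism_sph_coproduct])

lemma crossed_coproduct_zero [simp]: "crossed_coproduct 0 = 0"
  using crossed_coproduct_add[of 0 0] by simp

lemma crossed_coproduct_scale:
  "crossed_coproduct (crossed_scale c x) = crossed2_scale c (crossed_coproduct x)"
  by (simp add: crossed_coproduct_def crossed_scale.rep_eq sph_scale_def crossed2_scale_sum
      ring_morphism.h_mult[OF ring_morphism_sph_coproduct] sph_coproduct_const tensor_diag_scale)

lemma crossed_coproduct_smash: "crossed_coproduct (smash f u) = tensor_diag u (sph_coproduct f)"
proof -
  have "tensor_diag v (sph_coproduct (if v = u then f else 0)) =
      (if v = u then tensor_diag u (sph_coproduct f) else 0)" for v
    by (simp add: ring_morphism.h_zero[OF ring_morphism_sph_coproduct])
  then show ?thesis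
    by (simp add: crossed_coproduct_def crossed_coeff_smash)
qed

lemma crossed_coproduct_T_one: "crossed_coproduct (T_one u) = T_one u \<otimes>\<^sub>D T_one u"
  by (simp add: T_one_def crossed_coproduct_smash ring_morphism.h_one[OF ring_morphism_sph_coproduct]
      tensor_diag_tensor flip: sph_tensor_one)

lemma crossed_coproduct_T_gen:
  "crossed_coproduct (T_gen c u) = (\<Sum>(a, b) | a + b = c. cochain a b * (T_gen a u \<otimes>\<^sub>D T_gen b u))"
  by (simp add: T_gen_def crossed_coproduct_smash sph_coproduct_gen gen_coproduct_def
      tensor_diag_sum tensor_diag_cochain tensor_diag_tensor case_prod_unfold)

lemma tensor_right_add1: "tensor_right (s + t) z = tensor_right s z + tensor_right t z"
  by (cases s rule: crossed2_cases; cases t rule: crossed2_cases)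
    (simp add: plus_crossed2.abs_eq tensor_right.abs_eq plus_crossed3.abs_eq)

lemma tensor_right_zero [simp]: "tensor_right 0 z = 0"
  using tensor_right_add1[of 0 0 z] by simp

lemma tensor_right_add2: "tensor_right s (y + z) = tensor_right s y + tensor_right s z"
proof (induction s rule: crossed2_induct)
  case (tensor a b)
  show ?case
    by (simp only: tensor_right_tensor plus_crossed3.abs_eq crossed3.abs_eq_iff crossed.triple_add3)
qed (simp_all add: tensor_right_add1)

lemma tensor_left_add2: "tensor_left x (s + t) = tensor_left x s + tensor_left x t"
  by (cases s rule: crossed2_cases; cases t rule: crossed2_cases)
    (simp add: plus_crossed2.abs_eq tensor_left.abs_eq plus_crossed3.abs_eq)

lemma tensor_left_zero2 [simp]: "tensor_left x 0 = 0"
  using tensor_left_add2[of x 0 0] by simp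

lemma tensor_left_add1: "tensor_left (x + y) s = tensor_left x s + tensor_left y s"
proof (induction s rule: crossed2_induct)
  case (tensor a b)
  show ?case
    by (simp only: tensor_left_tensor plus_crossed3.abs_eq crossed3.abs_eq_iff crossed.triple_add1)
qed (simp_all add: tensor_left_add2)

lemma tensor_left_zero [simp]: "tensor_left 0 s = 0"
  using tensor_left_add1[of 0 0 s] by simp

lemma tensor_right_scale:
  "tensor_right (crossed2_scale c s) z = tensor_right s (crossed_scale c z)"
proof (induction s rule: crossed2_induct)
  case (tensor a b)
  show ?case
    using tensor3_trans[OF tensor3_scale12[of crossed_scale c a b z] tensor3_scale23]
    by (simp only: crossed2_scale_tensor tensor_right_tensor crossed3.abs_eq_iff)
qed (simp_all add: tensor_right_add1 crossed2_scale_add)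

lemma tensor_left_scale:
  "tensor_left (crossed_scale c x) s = tensor_left x (crossed2_scale c s)"
proof (induction s rule: crossed2_induct)
  case (tensor a b)
  show ?case
    by (simp only: crossed2_scale_tensor tensor_left_tensor crossed3.abs_eq_iff tensor3_scale12)
qed (simp_all add: tensor_left_add2 crossed2_scale_add)

text \<open>The maps \<open>\<delta> \<otimes> id\<close> and \<open>id \<otimes> \<delta>\<close> for the coproduct \<open>\<delta>\<close> of the crossed product.\<close>

lift_definition coproduct_left :: "'k::field crossed2 \<Rightarrow> 'k crossed3"
  is "\<lambda>M. \<Sum>(x, y)\<in>#M. tensor_right (crossed_coproduct x) y"
  by (erule eq_congruence.tensor2_lift)
    (simp_all only: case_prod_conv crossed_coproduct_zero crossed_coproduct_add
      crossed_coproduct_scale tensor_right_zero tensor_right_add1 tensor_right_add2 tensor_right_scale)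

lift_definition coproduct_right :: "'k::field crossed2 \<Rightarrow> 'k crossed3"
  is "\<lambda>M. \<Sum>(x, y)\<in>#M. tensor_left x (crossed_coproduct y)"
  by (erule eq_congruence.tensor2_lift)
    (simp_all only: case_prod_conv crossed_coproduct_add crossed_coproduct_scale
      tensor_left_zero tensor_left_add1 tensor_left_add2 tensor_left_scale)

section \<open>Twists\<close>

definition two_sided_inverse :: "'a::ring_1 \<Rightarrow> 'a \<Rightarrow> bool" where
  "two_sided_inverse x y \<longleftrightarrow> x * y = 1 \<and> y * x = 1"

definition is_twist :: "'k::field crossed2 \<Rightarrow> bool" where
  "is_twist J \<longleftrightarrow>
     (\<exists>J'. two_sided_inverse J J') \<and>
     coproduct_left J * tensor_right J 1 = coproduct_right J * tensor_left 1 J"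

definition p_zero :: "Z23 \<Rightarrow> 'k::field crossed" where
  "p_zero r = crossed_scale (1 / 2) (1 + T_one r)"

definition p_one :: "Z23 \<Rightarrow> 'k::field crossed" where
  "p_one r = crossed_scale (1 / 2) (1 - T_one r)"

definition J_elem :: "Z23 \<Rightarrow> 'k::field crossed2" where
  "J_elem r = p_zero r \<otimes>\<^sub>D 1 + p_one r \<otimes>\<^sub>D T_one r"

end

theory Submission
  imports Defs
begin

text \<open>
  The element \<open>t = T\<^sub>1\<^sup>r\<close> is group-like and satisfies \<open>t\<^sup>2 = 1\<close>. Since 2 is invertible, \<open>p\<^sub>0\<close> and \<open>p\<^sub>1\<close>
  are therefore complementary orthogonal idempotents, namely the projections onto the eigenspaces
  of multiplication by \<open>t\<close>:
  \<open>p\<^sub>0 + p\<^sub>1 = 1\<close>, \<open>p\<^sub>0 - p\<^sub>1 = t\<close>, \<open>p\<^sub>0 t = p\<^sub>0\<close> and \<open>p\<^sub>1 t = - p\<^sub>1\<close>. In \<open>J\<^sub>r\<^sup>2\<close> the mixed terms vanish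
  by orthogonality, which leaves \<open>p\<^sub>0 \<otimes> 1 + p\<^sub>1 \<otimes> t\<^sup>2 = 1\<close>.

  For the twist equation, only the coproduct on the span of 1 and \<open>t\<close> matters. As \<open>t\<close> is
  group-like, this span is a copy of the group algebra of a cyclic group of order two (of the
  trivial group if \<open>r = 0\<close>), on which the coproduct is coassociative.
  There the \<open>p\<^sub>i\<close> behave like the delta functions on the dual group: \<open>\<delta>(p\<^sub>k)\<close> is the sum of \<open>p\<^sub>i \<otimes> p\<^sub>j\<close> over
  \<open>i + j = k\<close> modulo 2 (\<open>coproduct_p_zero\<close>, \<open>coproduct_p_one\<close>). Conceptually, \<open>J\<^sub>r\<close> acts on the
  joint eigenspace of \<open>p\<^sub>i \<otimes> p\<^sub>j\<close> by the sign \<open>(-1)\<^sup>i\<^sup>j\<close>, which is a bicharacter and hence a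
  2-cocycle. Concretely, both sides of the twist equation reduce by the eigenvalue rules to
  \<open>p\<^sub>0 \<otimes> p\<^sub>0 \<otimes> 1 + p\<^sub>0 \<otimes> p\<^sub>1 \<otimes> t + p\<^sub>1 \<otimes> p\<^sub>0 \<otimes> t - p\<^sub>1 \<otimes> p\<^sub>1 \<otimes> 1\<close>.
\<close>

section \<open>Calculating with pure tensors\<close>

lemma tensor_add1: "(x + x') \<otimes>\<^sub>D y = x \<otimes>\<^sub>D y + x' \<otimes>\<^sub>D y"
  by (simp only: tensor_def plus_crossed2.abs_eq crossed2.abs_eq_iff crossed.pair_add1)

lemma tensor_add2: "x \<otimes>\<^sub>D (y + y') = x \<otimes>\<^sub>D y + x \<otimes>\<^sub>D y'"
  by (simp only: tensor_def plus_crossed2.abs_eq crossed2.abs_eq_iff crossed.pair_add2)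

lemma tensor_zero1 [simp]: "0 \<otimes>\<^sub>D y = 0"
  using tensor_add1[of 0 0 y] by simp

lemma tensor_zero2 [simp]: "x \<otimes>\<^sub>D 0 = 0"
  using tensor_add2[of x 0 0] by simp

lemma tensor_uminus1: "(- x) \<otimes>\<^sub>D y = - (x \<otimes>\<^sub>D y)"
  using tensor_add1[of x "- x" y] by (simp add: eq_neg_iff_add_eq_0 add.commute)

lemma tensor_uminus2: "x \<otimes>\<^sub>D (- y) = - (x \<otimes>\<^sub>D y)"
  using tensor_add2[of x y "- y"] by (simp add: eq_neg_iff_add_eq_0 add.commute)

lemma tensor_diff1: "(x - x') \<otimes>\<^sub>D y = x \<otimes>\<^sub>D y - x' \<otimes>\<^sub>D y"
  using tensor_add1[of x "- x'" y] by (simp add: tensor_uminus1)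

lemma tensor_diff2: "x \<otimes>\<^sub>D (y - y') = x \<otimes>\<^sub>D y - x \<otimes>\<^sub>D y'"
  using tensor_add2[of x y "- y'"] by (simp add: tensor_uminus2)

lemma tensor_mult: "(x \<otimes>\<^sub>D y) * (x' \<otimes>\<^sub>D y') = (x * x') \<otimes>\<^sub>D (y * y')"
  by (simp add: tensor_def times_crossed2.abs_eq)

lemma tensor_one: "1 \<otimes>\<^sub>D 1 = 1"
  by (simp add: tensor_def one_crossed2_def)

text \<open>Writing every triple tensor with the left bracketing makes its multilinearity available
  through \<open>tensor_right\<close>.\<close>

lemma tensor_left_eq_right: "tensor_left x (y \<otimes>\<^sub>D z) = tensor_right (x \<otimes>\<^sub>D y) z"
  by (simp add: tensor_left_tensor tensor_right_tensor)

lemma tensor_right_mult: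
  "tensor_right (x \<otimes>\<^sub>D y) z * tensor_right (x' \<otimes>\<^sub>D y') z' =
    tensor_right ((x * x') \<otimes>\<^sub>D (y * y')) (z * z')"
  by (simp add: tensor_right_tensor times_crossed3.abs_eq)

lemma tensor_right_uminus: "tensor_right (- s) z = - tensor_right s z"
  using tensor_right_add1[of s "- s" z] by (simp add: eq_neg_iff_add_eq_0 add.commute)

lemma coproduct_left_tensor:
  "coproduct_left (x \<otimes>\<^sub>D y) = tensor_right (crossed_coproduct x) y"
  by (simp add: tensor_def coproduct_left.abs_eq)

lemma coproduct_left_add: "coproduct_left (s + t) = coproduct_left s + coproduct_left t"
  by (cases s rule: crossed2_cases; cases t rule: crossed2_cases)
    (simp add: plus_crossed2.abs_eq coproduct_left.abs_eq)

lemma coproduct_right_tensor: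
  "coproduct_right (x \<otimes>\<^sub>D y) = tensor_left x (crossed_coproduct y)"
  by (simp add: tensor_def coproduct_right.abs_eq)

lemma coproduct_right_add: "coproduct_right (s + t) = coproduct_right s + coproduct_right t"
  by (cases s rule: crossed2_cases; cases t rule: crossed2_cases)
    (simp add: plus_crossed2.abs_eq coproduct_right.abs_eq)

section \<open>The complementary idempotents of a group-like involution\<close>

lemma T_one_0: "T_one 0 = 1"
  by (simp add: T_one_def one_crossed_eq)

lemma T_one_square: "T_one r * T_one r = 1"
  by (simp add: T_one_mult T_one_0)

lemma crossed_coproduct_one: "crossed_coproduct 1 = 1"
  using crossed_coproduct_T_one[of 0] by (simp add: T_one_0 tensor_one)

lemma crossed_coproduct_diff: "crossed_coproduct (x - y) = crossed_coproduct x - crossed_coproduct y"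
  using crossed_coproduct_add[of "x - y" y] by (simp add: algebra_simps)

lemma two_neq_0_of_char:
  assumes "CHAR('k::field) \<noteq> 2"
  shows "(2 :: 'k) \<noteq> 0"
proof
  assume "(2 :: 'k) = 0"
  then have "CHAR('k) dvd 2"
    using of_nat_eq_0_iff_char_dvd[where 'a = 'k, of 2] by simp
  then have "CHAR('k) \<le> 2" "CHAR('k) \<noteq> 0"
    by (auto dest: dvd_imp_le intro: Nat.gr0I)
  then show False
    using assms CHAR_not_1[where 'a = 'k] by linarith
qed

lemma crossed_scale_half:
  fixes x :: "'k::field crossed"
  assumes "(2 :: 'k) \<noteq> 0"
  shows "crossed_scale (1 / 2) (x + x) = x"
proof (rule coeff_eqI)
  interpret c: ring_morphism "sph_const :: 'k \<Rightarrow> _"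
    by (rule ring_morphism_sph_const)
  fix u
  have "sph_const (1 / 2) + sph_const (1 / 2) = (1 :: 'k sphere_alg)"
    using assms by (simp flip: c.h_add add: c.h_one)
  then show "crossed_coeff (crossed_scale (1 / 2) (x + x)) u = crossed_coeff x u"
    by (simp only: crossed_scale.rep_eq plus_crossed.rep_eq sph_scale_def distrib_left
        mult_1_left flip: distrib_right)
qed

lemma crossed2_scale_half:
  fixes s :: "'k::field crossed2"
  assumes "(2 :: 'k) \<noteq> 0"
  shows "crossed2_scale (1 / 2) (s + s) = s"
proof (induction s rule: crossed2_induct)
  case (tensor x y)
  show ?case
    by (simp add: crossed2_scale_tensor crossed_scale_half[OF assms] flip: tensor_add1)
next
  case (add s t)
  have "(s + t) + (s + t) = (s + s) + (t + t)"
    by (simp add: add_ac)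
  then show ?case
    using add by (simp only: crossed2_scale_add)
qed simp

context
  fixes r :: Z23
  assumes two: "(2 :: 'k::field) \<noteq> 0"
begin

private abbreviation "t \<equiv> T_one r :: 'k crossed"
private abbreviation "p \<equiv> p_zero r :: 'k crossed"
private abbreviation "q \<equiv> p_one r :: 'k crossed"

lemma p_zero_plus_p_one: "p + q = 1"
proof -
  have "p + q = crossed_scale (1 / 2) (1 + 1)"
    by (simp add: p_zero_def p_one_def flip: crossed.s_add)
  then show ?thesis
    by (simp add: crossed_scale_half[OF two] del: one_add_one)
qed

lemma p_zero_minus_p_one: "p - q = t"
proof -
  have "p - q = crossed_scale (1 / 2) (t + t)"
    by (simp add: p_zero_def p_one_def diff_conv_add_uminus flip: crossed.s_add crossed.s_uminus
        del: add_uminus_conv_diff)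
  then show ?thesis
    by (simp add: crossed_scale_half[OF two])
qed

lemma p_zero_mult_T_one: "p * t = p" and T_one_mult_p_zero: "t * p = p"
  by (simp_all add: p_zero_def crossed.s_mult_left crossed.s_mult_right distrib_left distrib_right
      T_one_square add.commute)

lemma p_one_mult_T_one: "q * t = - q" and T_one_mult_p_one: "t * q = - q"
  by (simp_all add: p_one_def crossed.s_mult_left crossed.s_mult_right left_diff_distrib
      right_diff_distrib T_one_square flip: crossed.s_uminus)

text \<open>The eigenvalue rules say \<open>p\<^sub>0 (1 - t) = 0\<close> and \<open>p\<^sub>1 (1 + t) = 0\<close>, and the second factors are
  twice the other idempotent.\<close>

lemma p_zero_mult_p_one: "p * q = 0" and p_one_mult_p_zero: "q * p = 0"
proof -
  show "p * q = 0"
    unfolding p_one_def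
    by (simp add: crossed.s_mult_right right_diff_distrib p_zero_mult_T_one)
  show "q * p = 0"
    unfolding p_zero_def
    by (simp add: crossed.s_mult_right distrib_left p_one_mult_T_one)
qed

lemma p_zero_idem: "p * p = p" and p_one_idem: "q * q = q"
proof -
  have "p * (p + q) = p" "q * (p + q) = q"
    by (simp_all only: p_zero_plus_p_one mult_1_right)
  then show "p * p = p" "q * q = q"
    by (simp_all add: distrib_left p_zero_mult_p_one p_one_mult_p_zero)
qed

text \<open>Expanding \<open>1 = p\<^sub>0 + p\<^sub>1\<close> and \<open>t = p\<^sub>0 - p\<^sub>1\<close> in \<open>1 \<otimes> 1 \<plusminus> t \<otimes> t\<close>, which is
  \<open>2 \<delta>(p\<^sub>0)\<close> for plus and \<open>2 \<delta>(p\<^sub>1)\<close> for minus, cancels two of the four products \<open>p\<^sub>i \<otimes> p\<^sub>j\<close> and doubles the other two.\<close>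

lemma coproduct_p_zero: "crossed_coproduct p = p \<otimes>\<^sub>D p + q \<otimes>\<^sub>D q"
proof -
  have "crossed_coproduct p = crossed2_scale (1 / 2) (1 \<otimes>\<^sub>D 1 + t \<otimes>\<^sub>D t)"
    unfolding p_zero_def
    by (simp add: crossed_coproduct_scale crossed_coproduct_add crossed_coproduct_one
        crossed_coproduct_T_one tensor_one)
  also have "1 \<otimes>\<^sub>D 1 + t \<otimes>\<^sub>D t = (p \<otimes>\<^sub>D p + q \<otimes>\<^sub>D q) + (p \<otimes>\<^sub>D p + q \<otimes>\<^sub>D q)"
    by (simp add: tensor_add1 tensor_add2 tensor_diff1 tensor_diff2
        flip: p_zero_plus_p_one p_zero_minus_p_one)
  finally show ?thesis
    by (simp only: crossed2_scale_half[OF two])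
qed

lemma coproduct_p_one: "crossed_coproduct q = p \<otimes>\<^sub>D q + q \<otimes>\<^sub>D p"
proof -
  have "crossed_coproduct q = crossed2_scale (1 / 2) (1 \<otimes>\<^sub>D 1 - t \<otimes>\<^sub>D t)"
    unfolding p_one_def
    by (simp add: crossed_coproduct_scale crossed_coproduct_diff crossed_coproduct_one
        crossed_coproduct_T_one tensor_one)
  also have "1 \<otimes>\<^sub>D 1 - t \<otimes>\<^sub>D t = (p \<otimes>\<^sub>D q + q \<otimes>\<^sub>D p) + (p \<otimes>\<^sub>D q + q \<otimes>\<^sub>D p)"
    by (simp add: tensor_add1 tensor_add2 tensor_diff1 tensor_diff2
        flip: p_zero_plus_p_one p_zero_minus_p_one)
  finally show ?thesis
    by (simp only: crossed2_scale_half[OF two])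
qed

section \<open>The twist\<close>

lemma J_elem_square: "J_elem r * J_elem r = (1 :: 'k crossed2)"
proof -
  have "J_elem r * J_elem r = p \<otimes>\<^sub>D 1 + q \<otimes>\<^sub>D 1"
    by (simp add: J_elem_def distrib_left distrib_right tensor_mult p_zero_idem p_one_idem
        p_zero_mult_p_one p_one_mult_p_zero T_one_square)
  then show ?thesis
    by (simp add: p_zero_plus_p_one tensor_one flip: tensor_add1)
qed

private abbreviation "twist_normal_form \<equiv>
  tensor_right (p \<otimes>\<^sub>D p) 1 + tensor_right (p \<otimes>\<^sub>D q) t
    + tensor_right (q \<otimes>\<^sub>D p) t - tensor_right (q \<otimes>\<^sub>D q) 1"

text \<open>The negative term is \<open>(p\<^sub>1 \<otimes> p\<^sub>1 \<otimes> 1)(p\<^sub>1 \<otimes> t \<otimes> 1) = p\<^sub>1 \<otimes> p\<^sub>1 t \<otimes> 1\<close>.\<close>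

lemma coproduct_left_J_mult:
  "coproduct_left (J_elem r) * tensor_right (J_elem r) 1 = twist_normal_form"
  by (simp add: J_elem_def coproduct_left_add coproduct_left_tensor coproduct_p_zero
      coproduct_p_one tensor_right_add1 tensor_right_mult distrib_left distrib_right
      p_zero_idem p_one_idem p_zero_mult_p_one p_one_mult_p_zero p_zero_mult_T_one
      p_one_mult_T_one tensor_uminus2 tensor_right_uminus)

text \<open>Here the same negative term arises as
  \<open>(p\<^sub>1 \<otimes> t \<otimes> t)(1 \<otimes> p\<^sub>1 \<otimes> t) = p\<^sub>1 \<otimes> t p\<^sub>1 \<otimes> t\<^sup>2\<close>. Rewriting the unit of \<open>D \<otimes> D\<close> as \<open>1 \<otimes> 1\<close> turns
  \<open>p\<^sub>0 \<otimes> \<delta>(1)\<close> into a pure tensor, to which the product rule applies.\<close>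

lemma coproduct_right_J_mult:
  "coproduct_right (J_elem r) * tensor_left 1 (J_elem r) = twist_normal_form"
  by (simp add: J_elem_def coproduct_right_add coproduct_right_tensor crossed_coproduct_one
      crossed_coproduct_T_one tensor_left_add2 tensor_left_eq_right tensor_right_mult
      distrib_left distrib_right T_one_mult_p_zero T_one_mult_p_one T_one_square
      tensor_uminus2 tensor_right_uminus flip: tensor_one)

end

theorem theorem3p2p2:
  fixes r :: Z23
  assumes "CHAR('k::field) \<noteq> 2"
  shows "is_twist (J_elem r :: 'k crossed2) \<and>
         two_sided_inverse (J_elem r :: 'k crossed2) (J_elem r)"
proof -
  note two = two_neq_0_of_char[OF assms]
  have "two_sided_inverse (J_elem r :: 'k crossed2) (J_elem r)"
    by (simp add: two_sided_inverse_def J_elem_square[OF two])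
  then show ?thesis
    unfolding is_twist_def
    by (auto simp: coproduct_left_J_mult[OF two] coproduct_right_J_mult[OF two])
qed

end
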